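(* Let $q$ be a prime power, $n\ge 1$, $N=1+q+\dots+q^n$ and $K=(n^2+3n+2)/2$. Let $C_n$ be the linear code over $\mathbb{F}_q$ of length $N$ and dimension $K$ whose generator matrix has as columns vectors representing the images of the $N$ points of $PG(n,q)$ (in a fixed order) under the quadratic Veronese map $(x_0,\dots,x_n)\mapsto (x_ix_j)_{0\le i\le j\le n}$ (monomials in a fixed order). Then the ordinary weight enumerator $\sum_{c\in C_n} Z^{\mathrm{wt}(c)}$ of $C_n$ equals $1+(q-1)W^{(1)}_{C_n}(Z)$, where \[ W^{(1)}_{C_n}(Z) = A_{q^n} Z^{q^n} + \sum_{t=1}^{\lfloor (n+1)/2 \rfloor} \left( A_{q^n - q^{n-t}} Z^{q^n - q^{n-t}} + A_{q^n + q^{n-t}} Z^{q^n + q^{n-t}} \right),\] with \[ A_{q^n + q^{n-t}} = \tfrac{1}{2} {n+1 \brack 2t}_q q^{t^2}(q^t-1) \prod_{i=1}^{t-1}(q^{2i+1}-1),\qquad A_{q^n - q^{n-t}} = \tfrac{1}{2} {n+1 \brack 2t}_q q^{t^2}(q^t+1) \prod_{i=1}^{t-1}(q^{2i+1}-1),\] \[ A_{q^n} = \sum_{t=0}^{\lfloor n/2 \rfloor} {n+1 \brack 2t+1}_q q^{t^2+t} \prod_{i=1}^{t}(q^{2i+1}-1).\]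
   Context: ${r \brack j}_q=\prod_{i=0}^{j-1}\frac{q^{r-i}-1}{q^{j-i}-1}$ denotes the Gaussian binomial coefficient (the number of $j$-dimensional subspaces of $\mathbb{F}_q^r$). The weight of a codeword is the number of its nonzero coordinates; a codeword corresponds to a quadratic form $f$ on $PG(n,q)$ and its weight is the number of points of $PG(n,q)$ at which $f$ does not vanish. *)

theory Defs
  imports "Jordan_Normal_Form.VS_Connect" "HOL-Computational_Algebra.Polynomial"
    "HOL-Library.Cardinality"
begin

definition gauss_binomial :: "nat \<Rightarrow> nat \<Rightarrow> nat \<Rightarrow> rat" where
  "gauss_binomial q r j = (\<Prod>i<j. (of_nat q ^ (r - i) - 1) / (of_nat q ^ (j - i) - 1))"


definition line :: "'a::field vec \<Rightarrow> 'a vec set" where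
  "line v = {c \<cdot>\<^sub>v v | c. True}"

text \<open>The points of PG(n,F) are the one-dimensional subspaces of the space of vectors of
  length n + 1; the vectors representing a point are its nonzero elements.\<close>

definition pg_points :: "nat \<Rightarrow> 'a::field vec set set" where
  "pg_points n = line ` (carrier_vec (n + 1) - {0\<^sub>v (n + 1)})"

text \<open>The order of the monomials is given by a function \<open>e\<close> sending a position to the pair of
  indices of the two variables.\<close>

definition monomial_order :: "nat \<Rightarrow> nat \<Rightarrow> (nat \<Rightarrow> nat \<times> nat) \<Rightarrow> bool" where
  "monomial_order n K e \<longleftrightarrow> bij_betw e {..<K} {(i, j). i \<le> j \<and> j \<le> n}"

definition veronese :: "nat \<Rightarrow> (nat \<Rightarrow> nat \<times> nat) \<Rightarrow> 'a::field vec \<Rightarrow> 'a vec" where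
  "veronese K e x = vec K (\<lambda>k. x $ fst (e k) * x $ snd (e k))"

text \<open>Rescaling \<open>x\<close> by \<open>a\<close> rescales its image by \<open>a\<^sup>2\<close>, so for a point \<open>X\<close> of PG(n,F) this is the
  single line spanned by the image of any nonzero \<open>x \<in> X\<close>.\<close>

definition veronese_point ::
  "nat \<Rightarrow> (nat \<Rightarrow> nat \<times> nat) \<Rightarrow> 'a::field vec set \<Rightarrow> 'a vec set" where
  "veronese_point K e X = (\<Union>x\<in>X. line (veronese K e x))"

definition veronese_matrix ::
  "nat \<Rightarrow> nat \<Rightarrow> (nat \<Rightarrow> nat \<times> nat) \<Rightarrow> (nat \<Rightarrow> 'a::field vec set) \<Rightarrow> 'a mat \<Rightarrow> bool" where
  "veronese_matrix N K e P G \<longleftrightarrow> G \<in> carrier_mat K N \<and>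
     (\<forall>j<N. col G j \<in> veronese_point K e (P j) - {0\<^sub>v K})"


definition linear_code :: "nat \<Rightarrow> nat \<Rightarrow> 'a::field vec set \<Rightarrow> bool" where
  "linear_code N K C \<longleftrightarrow>
     VectorSpace.subspace class_ring C (module_vec TYPE('a) N) \<and>
     vectorspace.dim class_ring ((module_vec TYPE('a) N)\<lparr>carrier := C\<rparr>) = K"

definition generated_code :: "'a::field mat \<Rightarrow> 'a vec set" where
  "generated_code G = vec_space.row_space (dim_col G) G"

definition wt :: "'a::zero vec \<Rightarrow> nat" where
  "wt c = card {j. j < dim_vec c \<and> c $ j \<noteq> 0}"

definition weight_enumerator :: "'a::zero vec set \<Rightarrow> rat poly" where
  "weight_enumerator C = (\<Sum>c\<in>C. monom 1 (wt c))"


text \<open>The numbers of codewords, up to nonzero scalars, of weights \<open>q ^ n + q ^ (n - t)\<close>,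
  \<open>q ^ n - q ^ (n - t)\<close> and \<open>q ^ n\<close>.\<close>

definition A_plus :: "nat \<Rightarrow> nat \<Rightarrow> nat \<Rightarrow> rat" where
  "A_plus q n t = 1 / 2 * gauss_binomial q (n + 1) (2 * t) * of_nat q ^ t\<^sup>2 *
     (of_nat q ^ t - 1) * (\<Prod>i=1..<t. of_nat q ^ (2 * i + 1) - 1)"

definition A_minus :: "nat \<Rightarrow> nat \<Rightarrow> nat \<Rightarrow> rat" where
  "A_minus q n t = 1 / 2 * gauss_binomial q (n + 1) (2 * t) * of_nat q ^ t\<^sup>2 *
     (of_nat q ^ t + 1) * (\<Prod>i=1..<t. of_nat q ^ (2 * i + 1) - 1)"

definition A_mid :: "nat \<Rightarrow> nat \<Rightarrow> rat" where
  "A_mid q n = (\<Sum>t=0..n div 2. gauss_binomial q (n + 1) (2 * t + 1) * of_nat q ^ (t\<^sup>2 + t) *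
     (\<Prod>i=1..t. of_nat q ^ (2 * i + 1) - 1))"

definition W1 :: "nat \<Rightarrow> nat \<Rightarrow> rat poly" where
  "W1 q n = monom (A_mid q n) (q ^ n) +
     (\<Sum>t=1..(n + 1) div 2. monom (A_minus q n t) (q ^ n - q ^ (n - t)) +
        monom (A_plus q n t) (q ^ n + q ^ (n - t)))"

end

theory Submission
  imports Defs "HOL-Library.Function_Algebras"
begin

text \<open>No classification of quadratic forms is needed. Count the pairs of a form \<open>f\<close> on a space \<open>V\<close> of
  dimension \<open>m\<close> and a nonzero \<open>v\<close> with \<open>f v = 0\<close>. Splitting \<open>V = U \<oplus> \<langle>v\<rangle>\<close> gives
  \<open>f (u + c v) = g u + c l u\<close> with \<open>g\<close> quadratic and \<open>l\<close> linear on \<open>U\<close>, and the number of zeros of \<open>f\<close>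
  is determined by that of \<open>g\<close> if \<open>l = 0\<close> and by that of the restriction of \<open>g\<close> to \<open>ker l\<close> otherwise.
  This expresses the distribution of the number \<open>\<zeta>\<close> of zeros, weighted by \<open>\<zeta> - 1\<close>, through the
  distributions in dimensions \<open>m - 1\<close> and \<open>m - 2\<close>. Together with the total number of forms, this
  recursion has a unique solution, in every characteristic, and the claimed numbers satisfy it.\<close>

section \<open>Gaussian binomials and the expected distribution\<close>

text \<open>A distribution of zero counts is treated as a functional: it sends a test function
  \<phi> to the sum of \<phi>(\<zeta>) over all forms. An identity for arbitrary \<phi> then
  compares all counts at once, and passing to a smaller space becomes a substitution in \<phi>. The
  weight \<zeta> - 1 is the number of nonzero zeros of a form, and each nonzero \<open>v\<close>
  contributes the same amount, whence the factor \<open>q^m - 1\<close>. A form with no nonzero zero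
  gets weight 0, so the recursion cannot detect it. This is why the total number of forms must be
  known on both sides. For actual forms it is \<open>q^(m(m+1)/2)\<close>; for the claimed numbers
  it amounts to counting alternating forms in dimension \<open>m + 1\<close> by rank, which is where
  \<open>alternating_count\<close> comes from.\<close>

lemma gauss_binomial_eq_0: "m < k \<Longrightarrow> gauss_binomial q m k = 0"
  unfolding gauss_binomial_def by (rule prod_zero) (auto intro!: bexI[of _ m])

lemma gauss_binomial_0_right [simp]: "gauss_binomial q m 0 = 1"
  by (simp add: gauss_binomial_def)

lemma of_nat_power_Suc_neq_1:
  assumes "q \<ge> 2"
  shows "(of_nat q :: rat) ^ Suc k - 1 \<noteq> 0"
proof -
  have "q ^ Suc k \<noteq> 1" using assms by simp
  hence "(of_nat (q ^ Suc k) :: rat) \<noteq> of_nat 1" by (simp only: of_nat_eq_iff) simp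
  thus ?thesis by simp
qed

lemma gauss_binomial_Suc_Suc:
  assumes "q \<ge> 2"
  shows "(of_nat q ^ Suc k - 1) * gauss_binomial q (Suc m) (Suc k)
    = (of_nat q ^ Suc m - 1) * gauss_binomial q m k"
proof -
  have "gauss_binomial q (Suc m) (Suc k)
      = (of_nat q ^ Suc m - 1) / (of_nat q ^ Suc k - 1) * gauss_binomial q m k"
    unfolding gauss_binomial_def by (subst prod.lessThan_Suc_shift) simp
  thus ?thesis using of_nat_power_Suc_neq_1[OF assms, of k] by (simp add: field_simps)
qed

text \<open>Prepending \<open>q^(m+1) - 1\<close> to the numerator for \<open>m\<close>, or
  appending one more factor to the numerator for \<open>m + 1\<close>, gives the same product of
  \<open>k + 1\<close> descending factors; the denominators agree.\<close>

lemma gauss_binomial_Suc_left: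
  "(of_nat q ^ Suc m - 1) * gauss_binomial q m k
    = (of_nat q ^ (Suc m - k) - 1) * gauss_binomial q (Suc m) k"
proof -
  define D :: rat where "D = (\<Prod>i<k. of_nat q ^ (k - i) - 1)"
  have gb: "gauss_binomial q r k = (\<Prod>i<k. of_nat q ^ (r - i) - 1) / D" for r
    unfolding gauss_binomial_def D_def by (rule prod_dividef)
  have "(of_nat q ^ Suc m - 1) * (\<Prod>i<k. (of_nat q :: rat) ^ (m - i) - 1)
      = (\<Prod>i<Suc k. of_nat q ^ (Suc m - i) - 1)"
    by (subst prod.lessThan_Suc_shift) simp
  also have "\<dots> = (of_nat q ^ (Suc m - k) - 1) * (\<Prod>i<k. of_nat q ^ (Suc m - i) - 1)"
    by simp
  finally show ?thesis unfolding gb by (simp add: field_simps)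
qed

text \<open>After multiplication by \<open>q^(m+1) - 1\<close>, both terms on the right become
  multiples of \<open>gauss_binomial q (Suc m) (Suc k)\<close>, and their factors telescope to
  \<open>q^(m+1) - 1\<close>.\<close>

lemma gauss_binomial_pascal:
  assumes "q \<ge> 2"
  shows "gauss_binomial q (Suc m) (Suc k)
    = gauss_binomial q m k + of_nat q ^ Suc k * gauss_binomial q m (Suc k)"
proof (cases "k \<le> m")
  case True
  define Q :: rat where "Q = of_nat q"
  have "(Q ^ Suc m - 1) * (gauss_binomial q m k + Q ^ Suc k * gauss_binomial q m (Suc k))
      = (Q ^ Suc k - 1) * gauss_binomial q (Suc m) (Suc k)
        + Q ^ Suc k * ((Q ^ (m - k) - 1) * gauss_binomial q (Suc m) (Suc k))"
    using gauss_binomial_Suc_Suc[OF assms, of k m] gauss_binomial_Suc_left[of q m "Suc k"]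
    by (simp add: Q_def distrib_left mult.left_commute)
  also have "\<dots> = (Q ^ Suc k * Q ^ (m - k) - 1) * gauss_binomial q (Suc m) (Suc k)"
    by (simp add: algebra_simps)
  also have "Q ^ Suc k * Q ^ (m - k) = Q ^ Suc m"
    using True by (simp flip: power_add)
  finally show ?thesis
    using of_nat_power_Suc_neq_1[OF assms, of m] by (simp add: Q_def)
qed (simp add: gauss_binomial_eq_0)

text \<open>The number of nondegenerate alternating bilinear forms on a space of dimension \<open>2t\<close>.\<close>

fun alternating_count :: "nat \<Rightarrow> nat \<Rightarrow> rat" where
  "alternating_count q 0 = 1"
| "alternating_count q (Suc t)
     = of_nat q ^ (2 * t) * (of_nat q ^ (2 * t + 1) - 1) * alternating_count q t"

text \<open>The closed forms here and in the next lemma exhibit the products occurring in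
  \<open>A_mid\<close>, \<open>A_minus\<close> and \<open>A_plus\<close>. The extra factor
  \<open>q - 1\<close> is the number of nonzero scalars, since those three count codewords up to
  scalars.\<close>

lemma alternating_count_Suc_eq:
  "alternating_count q (Suc t)
    = (of_nat q - 1) * of_nat q ^ (t\<^sup>2 + t) * (\<Prod>i=1..t. of_nat q ^ (2 * i + 1) - 1)"
proof (induction t)
  case (Suc t)
  have "(Suc t)\<^sup>2 + Suc t = 2 * Suc t + (t\<^sup>2 + t)" by (simp add: power2_eq_square)
  hence "of_nat q ^ ((Suc t)\<^sup>2 + Suc t) = (of_nat q ^ (2 * Suc t) * of_nat q ^ (t\<^sup>2 + t) :: rat)"
    by (simp only: power_add)
  thus ?case unfolding alternating_count.simps(2)[of q "Suc t"] Suc.IH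
    by (simp only: prod.nat_ivl_Suc' le_SucI mult_ac)
qed simp

lemma alternating_count_eq:
  assumes "t \<ge> 1"
  shows "of_nat q ^ t * alternating_count q t
    = (of_nat q - 1) * of_nat q ^ t\<^sup>2 * (\<Prod>i=1..<t. of_nat q ^ (2 * i + 1) - 1)"
proof -
  obtain s where t: "t = Suc s" using assms by (cases t) auto
  have "(Suc s)\<^sup>2 = Suc s + (s\<^sup>2 + s)" by (simp add: power2_eq_square)
  thus ?thesis unfolding t alternating_count_Suc_eq
    by (simp add: power_add mult_ac atLeastLessThanSuc_atLeastAtMost)
qed

text \<open>The recursion comes from bordering an alternating matrix of rank \<open>2t\<close> by a row and a
  column, which keeps the rank for \<open>q\<^bsup>2t\<^esup>\<close> of the \<open>q\<^bsup>m\<^esup>\<close> choices and raises it by two otherwise.\<close>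

lemma sum_alternating_count:
  assumes "q \<ge> 2"
  shows "(\<Sum>t\<le>m. gauss_binomial q m (2 * t) * alternating_count q t)
    = of_nat q ^ (m * (m - 1) div 2)"
proof (induction m)
  case (Suc m)
  define Q :: rat where "Q = of_nat q"
  define a where "a k t = gauss_binomial q k (2 * t) * alternating_count q t" for k t
  have a0: "a m (Suc m) = 0" by (simp add: a_def gauss_binomial_eq_0)
  have step: "a (Suc m) (Suc t) = Q ^ (2 * Suc t) * a m (Suc t) + (Q ^ m - Q ^ (2 * t)) * a m t" for t
  proof (cases "2 * t \<le> m")
    case True
    \<comment> \<open>The ratio of neighbouring binomials in row \<open>m\<close>, obtained by a
      detour through row \<open>Suc m\<close>.\<close>
    have "(Q ^ (2 * t + 1) - 1) * gauss_binomial q m (2 * t + 1)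
        = (Q ^ (m - 2 * t) - 1) * gauss_binomial q m (2 * t)"
    proof -
      have "(Q ^ Suc m - 1) * ((Q ^ (2 * t + 1) - 1) * gauss_binomial q m (2 * t + 1))
        = (Q ^ (m - 2 * t) - 1) * ((Q ^ (2 * t + 1) - 1) * gauss_binomial q (Suc m) (2 * t + 1))"
        using gauss_binomial_Suc_left[of q m "2 * t + 1"] by (simp add: Q_def mult_ac)
      also have "\<dots> = (Q ^ Suc m - 1) * ((Q ^ (m - 2 * t) - 1) * gauss_binomial q m (2 * t))"
        using gauss_binomial_Suc_Suc[OF assms, of "2 * t" m] by (simp add: Q_def mult_ac)
      finally show ?thesis using of_nat_power_Suc_neq_1[OF assms, of m] by (simp add: Q_def)
    qed
    hence "gauss_binomial q m (2 * t + 1) * alternating_count q (Suc t)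
        = Q ^ (2 * t) * (Q ^ (m - 2 * t) - 1) * a m t"
      by (simp add: a_def Q_def mult_ac)
    also have "Q ^ (2 * t) * (Q ^ (m - 2 * t) - 1) = Q ^ m - Q ^ (2 * t)"
      using True by (simp add: right_diff_distrib flip: power_add)
    finally show ?thesis
      using gauss_binomial_pascal[OF assms, of m "2 * t + 1"]
      by (simp add: a_def Q_def algebra_simps del: alternating_count.simps)
  qed (simp add: a_def gauss_binomial_eq_0)
  have "(\<Sum>t\<le>Suc m. a (Suc m) t)
      = a (Suc m) 0 + (\<Sum>t\<le>m. Q ^ (2 * Suc t) * a m (Suc t)) + (\<Sum>t\<le>m. (Q ^ m - Q ^ (2 * t)) * a m t)"
    by (simp only: sum.atMost_Suc_shift step sum.distrib add.assoc)
  also have "a (Suc m) 0 + (\<Sum>t\<le>m. Q ^ (2 * Suc t) * a m (Suc t)) = (\<Sum>t\<le>Suc m. Q ^ (2 * t) * a m t)"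
    by (subst sum.atMost_Suc_shift) (simp add: a_def)
  also have "\<dots> = (\<Sum>t\<le>m. Q ^ (2 * t) * a m t)" by (simp add: a0)
  \<comment> \<open>The terms with \<open>Q ^ (2 * t)\<close> cancel: every alternating matrix of
    order \<open>m\<close> has the same number \<open>Q ^ m\<close> of borderings.\<close>
  also have "\<dots> + (\<Sum>t\<le>m. (Q ^ m - Q ^ (2 * t)) * a m t) = Q ^ m * (\<Sum>t\<le>m. a m t)"
    by (simp add: sum_distrib_left algebra_simps flip: sum.distrib)
  also have "\<dots> = Q ^ (m + m * (m - 1) div 2)"
    using Suc.IH by (simp add: a_def Q_def power_add)
  also have "m + m * (m - 1) div 2 = Suc m * (Suc m - 1) div 2"
  proof -
    have "2 * m + m * (m - 1) = Suc m * m" by (cases m) auto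
    thus ?thesis by (metis diff_Suc_1 div_mult_self4 zero_neq_numeral)
  qed
  finally show ?case by (simp add: a_def Q_def)
qed simp

section \<open>The expected distribution of zero counts and its recursion\<close>

text \<open>Intended as the number of forms of rank \<open>2t + 1\<close> in dimension
  \<open>m\<close>: the Gaussian binomial chooses the radical, and there are as many nondegenerate
  quadratic forms in \<open>2t + 1\<close> variables as nondegenerate alternating forms in
  \<open>2t + 2\<close>.\<close>

definition odd_rank_count :: "nat \<Rightarrow> nat \<Rightarrow> nat \<Rightarrow> rat" where
  "odd_rank_count q m t = gauss_binomial q m (2 * t + 1) * alternating_count q (Suc t)"

text \<open>The sign \<open>s\<close> is \<open>1\<close> for hyperbolic and \<open>-1\<close> for elliptic forms.\<close>

definition even_rank_count :: "nat \<Rightarrow> rat \<Rightarrow> nat \<Rightarrow> nat \<Rightarrow> rat" where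
  "even_rank_count q s m t
    = 1 / 2 * gauss_binomial q m (2 * t) * of_nat q ^ t * (of_nat q ^ t + s) * alternating_count q t"

text \<open>Dividing by \<open>q\<close> instead of lowering the exponents keeps the value correct
  for \<open>m = t = 0\<close> and \<open>s = 1\<close>, where truncated subtraction would give
  \<open>q\<close> instead of 1.\<close>

definition even_rank_zeros :: "nat \<Rightarrow> rat \<Rightarrow> nat \<Rightarrow> nat \<Rightarrow> rat" where
  "even_rank_zeros q s m t = (of_nat q ^ m + s * (of_nat q - 1) * of_nat q ^ (m - t)) / of_nat q"

definition zero_enum_term :: "nat \<Rightarrow> nat \<Rightarrow> (rat \<Rightarrow> rat) \<Rightarrow> nat \<Rightarrow> rat" where
  "zero_enum_term q m \<phi> t
    = odd_rank_count q m t * \<phi> (of_nat q ^ m / of_nat q)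
      + even_rank_count q 1 m t * \<phi> (even_rank_zeros q 1 m t)
      + even_rank_count q (-1) m t * \<phi> (even_rank_zeros q (-1) m t)"

definition zero_enum :: "nat \<Rightarrow> nat \<Rightarrow> (rat \<Rightarrow> rat) \<Rightarrow> rat" where
  "zero_enum q m \<phi> = (\<Sum>t\<le>m. zero_enum_term q m \<phi> t)"

lemma odd_rank_count_eq_0: "m < 2 * t + 1 \<Longrightarrow> odd_rank_count q m t = 0"
  and even_rank_count_eq_0: "m < 2 * t \<Longrightarrow> even_rank_count q s m t = 0"
  by (simp_all add: odd_rank_count_def even_rank_count_def gauss_binomial_eq_0)

lemma zero_enum_term_eq_0: "m < t \<Longrightarrow> zero_enum_term q m \<phi> t = 0"
  by (simp add: zero_enum_term_def odd_rank_count_eq_0 even_rank_count_eq_0)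

lemma gauss_binomial_step2:
  assumes "q \<ge> 2"
  shows "(of_nat q ^ (m + 2) - 1) * ((of_nat q ^ (m + 1) - 1) * gauss_binomial q m k)
    = (of_nat q ^ (k + 2) - 1) * ((of_nat q ^ (k + 1) - 1) * gauss_binomial q (m + 2) (k + 2))"
proof -
  define Q :: rat where "Q = of_nat q"
  have 1: "(Q ^ (m + 1) - 1) * gauss_binomial q m k
      = (Q ^ (k + 1) - 1) * gauss_binomial q (m + 1) (k + 1)"
    using gauss_binomial_Suc_Suc[OF assms, of k m] by (simp add: Q_def)
  have 2: "(Q ^ (m + 2) - 1) * gauss_binomial q (m + 1) (k + 1)
      = (Q ^ (k + 2) - 1) * gauss_binomial q (m + 2) (k + 2)"
    using gauss_binomial_Suc_Suc[OF assms, of "k + 1" "m + 1"] by (simp add: Q_def)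
  show ?thesis
    unfolding Q_def[symmetric] 1 mult.left_commute[of "Q ^ (m + 2) - 1"] 2 by (rule mult.left_commute)
qed

lemma odd_rank_count_rec_0:
  assumes "q \<ge> 2"
  shows "(of_nat q ^ m - 1) * odd_rank_count q (Suc m) 0
    = (of_nat q ^ Suc m - 1) * odd_rank_count q m 0"
  using gauss_binomial_Suc_left[of q m 1]
  by (simp add: odd_rank_count_def)

text \<open>In the intended meaning both sides count pairs of a form of rank \<open>2t + 3\<close>
  in dimension \<open>m + 2\<close> and a nonzero zero \<open>v\<close>. If \<open>l = 0\<close>,
  the rank is that of \<open>g\<close>; for each of the \<open>q^(m+1) - 1\<close> other
  \<open>l\<close>, a hyperbolic plane splits off and the rank drops by two, and
  \<open>q^(m+1)\<close> is the number of extensions of a form from \<open>ker l\<close> to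
  \<open>U\<close>. The proof is a computation: all binomials are reduced to
  \<open>g\<close>.\<close>

lemma odd_rank_count_rec:
  assumes "q \<ge> 2"
  shows "(of_nat q ^ (m + 1) - 1) * odd_rank_count q (m + 2) (Suc t)
    = (of_nat q ^ (m + 2) - 1) * (odd_rank_count q (m + 1) (Suc t)
        + (of_nat q ^ (m + 1) - 1) * of_nat q ^ (m + 1) * odd_rank_count q m t)"
proof (cases "2 * t + 1 \<le> m")
  case True
  define Q :: rat where "Q = of_nat q"
  define g where "g = gauss_binomial q (m + 2) (2 * t + 3)"
  define A where "A = alternating_count q (Suc t)"
  define d where "d = m - (2 * t + 1)"
  have 1: "(Q ^ (m + 2) - 1) * gauss_binomial q (m + 1) (2 * t + 3) = (Q ^ d - 1) * g"
    using gauss_binomial_Suc_left[of q "m + 1" "2 * t + 3"] True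
    by (simp add: Q_def g_def d_def)
  have 2: "(Q ^ (m + 2) - 1) * ((Q ^ (m + 1) - 1) * gauss_binomial q m (2 * t + 1))
      = (Q ^ (2 * t + 3) - 1) * ((Q ^ (2 * t + 2) - 1) * g)"
    using gauss_binomial_step2[OF assms, of m "2 * t + 1"]
    by (simp add: Q_def g_def numeral_3_eq_3 del: power_Suc)
  have 3: "alternating_count q (Suc (Suc t)) = Q ^ (2 * t + 2) * (Q ^ (2 * t + 3) - 1) * A"
    by (simp add: A_def Q_def numeral_3_eq_3 del: alternating_count.simps(2))
      (simp add: alternating_count.simps(2)[of q "Suc t"] del: alternating_count.simps(2))
  have 4: "Q ^ (m + 1) = Q ^ (2 * t + 2) * Q ^ d"
  proof -
    have "m + 1 = (2 * t + 2) + d" using True by (simp add: d_def)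
    thus ?thesis by (simp only: power_add)
  qed
  have o: "odd_rank_count q k (Suc t)
      = gauss_binomial q k (2 * t + 3) * (Q ^ (2 * t + 2) * (Q ^ (2 * t + 3) - 1) * A)" for k
    unfolding odd_rank_count_def 3 by (simp add: numeral_3_eq_3)
  have "(Q ^ (m + 2) - 1) * (odd_rank_count q (m + 1) (Suc t)
        + (Q ^ (m + 1) - 1) * Q ^ (m + 1) * odd_rank_count q m t)
      = ((Q ^ (m + 2) - 1) * gauss_binomial q (m + 1) (2 * t + 3))
          * (Q ^ (2 * t + 2) * (Q ^ (2 * t + 3) - 1) * A)
        + ((Q ^ (m + 2) - 1) * ((Q ^ (m + 1) - 1) * gauss_binomial q m (2 * t + 1))) * (Q ^ (m + 1) * A)"
    unfolding o by (simp only: odd_rank_count_def A_def ring_distribs mult_ac)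
  also have "\<dots> = (Q ^ (m + 1) - 1) * odd_rank_count q (m + 2) (Suc t)"
    unfolding 1 2 unfolding o 4 g_def[symmetric] by (simp add: algebra_simps)
  finally show ?thesis by (simp add: Q_def)
qed (simp add: odd_rank_count_eq_0)

text \<open>For \<open>s = 1\<close> the count is 1, standing for the zero form, which vanishes
  everywhere; for \<open>s = -1\<close> both counts are 0.\<close>

lemma even_rank_count_rec_0:
  assumes "q \<ge> 2" and "s * s = 1"
  shows "(even_rank_zeros q s (Suc m) 0 - 1) * even_rank_count q s (Suc m) 0
    = (of_nat q ^ Suc m - 1) * even_rank_count q s m 0"
proof -
  have "s = 1 \<or> s = -1" using assms(2) by (simp add: square_eq_1_iff)
  thus ?thesis using assms(1) by (auto simp: even_rank_zeros_def even_rank_count_def field_simps)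
qed

lemma even_rank_zeros_step1:
  assumes "q \<ge> 2" and "t \<le> m"
  shows "of_nat q * even_rank_zeros q s m t = even_rank_zeros q s (Suc m) t"
  using assms by (simp add: even_rank_zeros_def Suc_diff_le field_simps)

text \<open>The effect of adding a hyperbolic plane: \<open>(q - 1) * q^m\<close> is the number of
  vectors outside a hyperplane in dimension \<open>m + 1\<close>. The sign \<open>s\<close> is
  preserved.\<close>

lemma even_rank_zeros_step2:
  assumes "q \<ge> 2" and "t \<le> m"
  shows "(of_nat q - 1) * of_nat q ^ m + of_nat q * even_rank_zeros q s m t
    = even_rank_zeros q s (m + 2) (Suc t)"
  using assms by (simp add: even_rank_zeros_def Suc_diff_le field_simps)

text \<open>The same count of pairs as for odd rank, for each sign separately; now the number of
  zeros of a form depends on \<open>t\<close> and \<open>s\<close>.\<close>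

lemma even_rank_count_rec:
  assumes "q \<ge> 2" and "s * s = 1"
  shows "(even_rank_zeros q s (m + 2) (Suc t) - 1) * even_rank_count q s (m + 2) (Suc t)
    = (of_nat q ^ (m + 2) - 1) * (even_rank_count q s (m + 1) (Suc t)
        + (of_nat q ^ (m + 1) - 1) * of_nat q ^ (m + 1) * even_rank_count q s m t)"
proof (cases "2 * t \<le> m")
  case True
  define Q :: rat where "Q = of_nat q"
  define g where "g = gauss_binomial q (m + 2) (2 * t + 2)"
  define A where "A = alternating_count q t / 2"
  define d where "d = m - 2 * t"
  define R where "R = Q ^ t"
  define D where "D = Q ^ d"
  have Q0: "Q \<noteq> 0" using assms(1) by (simp add: Q_def)
  have R: "Q ^ (2 * t + 2) = R\<^sup>2 * Q\<^sup>2" "Q ^ (2 * t + 1) = R\<^sup>2 * Q" "Q ^ (2 * t) = R\<^sup>2" "Q ^ Suc t = Q * R"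
    by (simp_all add: R_def power_add mult_2 power2_eq_square)
  have m: "Q ^ (m + 1) = D * R\<^sup>2 * Q"
    using True by (simp add: D_def d_def flip: R(3) power_add power_Suc2)
  have 1: "(Q ^ (m + 2) - 1) * gauss_binomial q (m + 1) (2 * t + 2) = (D - 1) * g"
    using gauss_binomial_Suc_left[of q "m + 1" "2 * t + 2"] True
    by (simp add: Q_def g_def D_def d_def)
  have 2: "(Q ^ (m + 2) - 1) * ((Q ^ (m + 1) - 1) * gauss_binomial q m (2 * t))
      = (R\<^sup>2 * Q\<^sup>2 - 1) * ((R\<^sup>2 * Q - 1) * g)"
    by (rule gauss_binomial_step2[OF assms(1), of m "2 * t", folded Q_def g_def, unfolded R])
  have 3: "alternating_count q (Suc t) = 2 * (R\<^sup>2 * (R\<^sup>2 * Q - 1) * A)"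
    by (simp add: A_def flip: R) (simp add: Q_def)
  have o: "even_rank_count q s k (Suc t)
      = gauss_binomial q k (2 * t + 2) * ((Q * R) * (Q * R + s) * (R\<^sup>2 * (R\<^sup>2 * Q - 1) * A))" for k
    unfolding even_rank_count_def 3 Q_def[symmetric] R by (simp add: mult_ac)
  have e: "even_rank_count q s m t = gauss_binomial q m (2 * t) * (R * (R + s) * A)"
    unfolding even_rank_count_def by (simp add: Q_def R_def A_def)
  have z: "even_rank_zeros q s (m + 2) (Suc t) = D * R\<^sup>2 * Q + s * (Q - 1) * (D * R)"
  proof -
    have "Q ^ (m + 2 - Suc t) = Q * (D * R)"
    proof -
      have "m + 2 - Suc t = Suc (d + t)" using True by (simp add: d_def)
      thus ?thesis by (simp only: D_def R_def power_Suc power_add)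
    qed
    moreover have "Q ^ (m + 2) = Q * (D * R\<^sup>2 * Q)" by (simp flip: m)
    ultimately show ?thesis using Q0
      by (simp add: even_rank_zeros_def Q_def[symmetric] field_simps)
  qed
  have "(Q ^ (m + 2) - 1) * (even_rank_count q s (m + 1) (Suc t)
        + (Q ^ (m + 1) - 1) * Q ^ (m + 1) * even_rank_count q s m t)
      = ((Q ^ (m + 2) - 1) * gauss_binomial q (m + 1) (2 * t + 2))
          * ((Q * R) * (Q * R + s) * (R\<^sup>2 * (R\<^sup>2 * Q - 1) * A))
        + ((Q ^ (m + 2) - 1) * ((Q ^ (m + 1) - 1) * gauss_binomial q m (2 * t)))
          * (Q ^ (m + 1) * (R * (R + s) * A))"
    unfolding o e by (simp only: ring_distribs mult_ac)
  \<comment> \<open>Writing 1 as \<open>s * s\<close> turns \<open>R\<^sup>2 * Q\<^sup>2 - 1\<close>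
    into a difference of squares and brings out the factor \<open>Q * R + s\<close> of the left-hand
    count; what remains is the number of zeros minus one.\<close>
  also have "\<dots> = g * Q * R ^ 3 * A * (R\<^sup>2 * Q - 1)
      * ((D - 1) * (Q * R + s) + D * (R\<^sup>2 * Q\<^sup>2 - s * s) * (R + s))"
    unfolding 1 2 unfolding m assms(2)
    by (simp add: algebra_simps power2_eq_square power3_eq_cube)
  also have "(D - 1) * (Q * R + s) + D * (R\<^sup>2 * Q\<^sup>2 - s * s) * (R + s)
      = (Q * R + s) * (D - 1 + D * (R * Q - s) * (R + s))"
    by (simp add: algebra_simps power2_eq_square)
  also have "D - 1 + D * (R * Q - s) * (R + s) = D * R\<^sup>2 * Q + s * (Q - 1) * (D * R) - 1"
  proof -
    have "D - 1 + D * (R * Q - s) * (R + s) = D - 1 + D * (R\<^sup>2 * Q + s * (Q - 1) * R - s * s)"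
      by (simp add: algebra_simps power2_eq_square)
    thus ?thesis unfolding assms(2) by (simp add: algebra_simps)
  qed
  also have "g * Q * R ^ 3 * A * (R\<^sup>2 * Q - 1)
      * ((Q * R + s) * (D * R\<^sup>2 * Q + s * (Q - 1) * (D * R) - 1))
      = (even_rank_zeros q s (m + 2) (Suc t) - 1) * even_rank_count q s (m + 2) (Suc t)"
    unfolding z o g_def by (simp add: algebra_simps power2_eq_square power3_eq_cube)
  finally show ?thesis by (simp add: Q_def)
qed (simp add: even_rank_count_eq_0)

lemma zero_enum_0: "q \<ge> 2 \<Longrightarrow> zero_enum q 0 \<phi> = \<phi> 1"
  by (simp add: zero_enum_def zero_enum_term_def odd_rank_count_eq_0 even_rank_count_def
      even_rank_zeros_def)

lemma zero_enum_1:
  assumes "q \<ge> 2"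
  shows "zero_enum q 1 \<phi> = \<phi> (of_nat q) + (of_nat q - 1) * \<phi> 1"
proof -
  have "gauss_binomial q (Suc 0) (Suc 0) = 1"
    using of_nat_power_Suc_neq_1[OF assms, of 0] by (simp add: gauss_binomial_def)
  moreover have "(of_nat q + (of_nat q - 1) * of_nat q) / of_nat q = (of_nat q :: rat)"
    using assms by (simp add: field_simps)
  ultimately show ?thesis using assms
    by (simp add: zero_enum_def zero_enum_term_def odd_rank_count_def even_rank_count_def
      even_rank_zeros_def gauss_binomial_eq_0)
qed

lemma zero_enum_rec:
  assumes q: "q \<ge> 2"
  shows "zero_enum q (m + 2) (\<lambda>\<zeta>. (\<zeta> - 1) * \<phi> \<zeta>)
    = (of_nat q ^ (m + 2) - 1) * (zero_enum q (m + 1) (\<lambda>\<zeta>. \<phi> (of_nat q * \<zeta>))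
        + (of_nat q ^ (m + 1) - 1) * of_nat q ^ (m + 1)
          * zero_enum q m (\<lambda>\<zeta>. \<phi> ((of_nat q - 1) * of_nat q ^ m + of_nat q * \<zeta>)))"
    (is "zero_enum q _ ?\<psi> = ?c * (zero_enum q _ ?\<phi>1 + ?b * zero_enum q _ ?\<phi>2)")
proof -
  have Q0: "(of_nat q :: rat) \<noteq> 0" using q by simp
  have mid1: "of_nat q * (of_nat q ^ (m + 1) / of_nat q) = (of_nat q ^ (m + 2) / of_nat q :: rat)"
    using Q0 by simp
  have mid2: "(of_nat q - 1) * of_nat q ^ m + of_nat q * (of_nat q ^ m / of_nat q)
      = (of_nat q ^ (m + 2) / of_nat q :: rat)"
    using Q0 by (simp add: field_simps)
  have mid: "of_nat q ^ (m + 2) / of_nat q = (of_nat q ^ (m + 1) :: rat)"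
    using Q0 by simp
  \<comment> \<open>Outside the range where the formula for the number of zeros holds, the
    coefficient is 0, so the equation is valid for all \<open>t\<close>.\<close>
  have even1: "even_rank_count q s (m + 1) t * \<phi> (of_nat q * even_rank_zeros q s (m + 1) t)
      = even_rank_count q s (m + 1) t * \<phi> (even_rank_zeros q s (m + 2) t)" for s t
    using even_rank_zeros_step1[OF q, of t "m + 1" s]
    by (cases "t \<le> m + 1") (simp_all add: even_rank_count_eq_0)
  have even2: "even_rank_count q s m t
        * \<phi> ((of_nat q - 1) * of_nat q ^ m + of_nat q * even_rank_zeros q s m t)
      = even_rank_count q s m t * \<phi> (even_rank_zeros q s (m + 2) (Suc t))" for s t
    using even_rank_zeros_step2[OF q, of t m s]
    by (cases "t \<le> m") (simp_all add: even_rank_count_eq_0)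
  have odd: "(of_nat q ^ (m + 2) / of_nat q - 1) * odd_rank_count q (m + 2) (Suc t)
      = (of_nat q ^ (m + 2) - 1) * (odd_rank_count q (m + 1) (Suc t)
        + (of_nat q ^ (m + 1) - 1) * of_nat q ^ (m + 1) * odd_rank_count q m t)" for t
    unfolding mid by (rule odd_rank_count_rec[OF q])
  have odd0: "(of_nat q ^ (m + 2) / of_nat q - 1) * odd_rank_count q (m + 2) 0
      = (of_nat q ^ (m + 2) - 1) * odd_rank_count q (m + 1) 0"
    unfolding mid using odd_rank_count_rec_0[OF q, of "m + 1"] by simp
  have even0: "(even_rank_zeros q s (m + 2) 0 - 1) * even_rank_count q s (m + 2) 0
      = (of_nat q ^ (m + 2) - 1) * even_rank_count q s (m + 1) 0" if "s * s = 1" for s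
    using even_rank_count_rec_0[OF q that, of "m + 1"] by simp
  have comb: "(a * (z0 * f0) + b * (z1 * f1) + c * (z2 * f2)
      = C * ((a' * f0 + b' * f1 + c' * f2) + B * (a'' * f0 + b'' * f1 + c'' * f2)))"
    if "z0 * a = C * (a' + B * a'')" "z1 * b = C * (b' + B * b'')" "z2 * c = C * (c' + B * c'')"
    for a b c z0 z1 z2 f0 f1 f2 C a' b' c' B a'' b'' c'' :: rat
  proof -
    have "a * (z0 * f0) + b * (z1 * f1) + c * (z2 * f2) = z0 * a * f0 + z1 * b * f1 + z2 * c * f2"
      by (simp only: mult_ac)
    thus ?thesis unfolding that by (simp only: ring_distribs mult_ac add_ac)
  qed
  \<comment> \<open>The index is shifted only in dimension \<open>m\<close>: losing a hyperbolic
    plane lowers \<open>t\<close> by one, while a cone over a form keeps \<open>t\<close>.\<close>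
  have step: "zero_enum_term q (m + 2) ?\<psi> (Suc t)
      = ?c * (zero_enum_term q (m + 1) ?\<phi>1 (Suc t) + ?b * zero_enum_term q m ?\<phi>2 t)" for t
    unfolding zero_enum_term_def even1 even2 mid1 mid2
    by (rule comb[OF odd
          even_rank_count_rec[OF q, of 1] even_rank_count_rec[OF q, of "-1"]]) simp_all
  have comb0: "(a * (z0 * f0) + b * (z1 * f1) + c * (z2 * f2)
      = C * (a' * f0 + b' * f1 + c' * f2))"
    if "z0 * a = C * a'" "z1 * b = C * b'" "z2 * c = C * c'"
    for a b c z0 z1 z2 f0 f1 f2 C a' b' c' :: rat
  proof -
    have "a * (z0 * f0) + b * (z1 * f1) + c * (z2 * f2) = z0 * a * f0 + z1 * b * f1 + z2 * c * f2"
      by (simp only: mult_ac)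
    thus ?thesis unfolding that by (simp only: ring_distribs mult_ac add_ac)
  qed
  have step0: "zero_enum_term q (m + 2) ?\<psi> 0 = ?c * zero_enum_term q (m + 1) ?\<phi>1 0"
    unfolding zero_enum_term_def even1 mid1
    by (rule comb0[OF odd0 even0[of 1] even0[of "-1"]]) simp_all
  have "zero_enum q (m + 2) ?\<psi>
      = zero_enum_term q (m + 2) ?\<psi> 0 + (\<Sum>t\<le>Suc m. zero_enum_term q (m + 2) ?\<psi> (Suc t))"
    unfolding zero_enum_def by (simp only: add_2_eq_Suc' sum.atMost_Suc_shift)
  also have "\<dots> = ?c * (zero_enum_term q (m + 1) ?\<phi>1 0 + (\<Sum>t\<le>Suc m. zero_enum_term q (m + 1) ?\<phi>1 (Suc t))
       + ?b * (\<Sum>t\<le>Suc m. zero_enum_term q m ?\<phi>2 t))"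
  proof -
    have "C * x + (\<Sum>t\<le>M. C * (f t + B * g t)) = C * (x + (\<Sum>t\<le>M. f t) + B * (\<Sum>t\<le>M. g t))"
      for C B x :: rat and f g and M :: nat
      by (simp add: sum.distrib distrib_left flip: sum_distrib_left)
    thus ?thesis unfolding step step0 .
  qed
  also have "zero_enum_term q (m + 1) ?\<phi>1 0 + (\<Sum>t\<le>Suc m. zero_enum_term q (m + 1) ?\<phi>1 (Suc t))
      = (\<Sum>t\<le>Suc (Suc m). zero_enum_term q (m + 1) ?\<phi>1 t)"
    by (rule sum.atMost_Suc_shift[symmetric])
  also have "\<dots> = zero_enum q (m + 1) ?\<phi>1"
    by (simp add: zero_enum_def zero_enum_term_eq_0)
  also have "(\<Sum>t\<le>Suc m. zero_enum_term q m ?\<phi>2 t) = zero_enum q m ?\<phi>2"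
    by (simp add: zero_enum_def zero_enum_term_eq_0)
  finally show ?thesis .
qed

text \<open>The recursion in a form that includes dimension 1: for \<open>m = 0\<close> the
  truncated \<open>m - 1\<close> is harmless, because the factor \<open>q^m - 1\<close>
  vanishes.\<close>

lemma zero_enum_Suc:
  assumes q: "q \<ge> 2"
  shows "zero_enum q (Suc m) (\<lambda>\<zeta>. (\<zeta> - 1) * \<phi> \<zeta>)
    = (of_nat q ^ Suc m - 1) * (zero_enum q m (\<lambda>\<zeta>. \<phi> (of_nat q * \<zeta>))
        + (of_nat q ^ m - 1) * of_nat q ^ m
          * zero_enum q (m - 1) (\<lambda>\<zeta>. \<phi> (of_nat q ^ m - of_nat q ^ (m - 1) + of_nat q * \<zeta>)))"
proof (cases m)
  case 0
  thus ?thesis using zero_enum_1[OF q] zero_enum_0[OF q] by simp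
next
  case (Suc k)
  thus ?thesis using zero_enum_rec[OF q, of k \<phi>] by (simp add: left_diff_distrib)
qed

text \<open>The total equals the number of alternating forms in dimension \<open>m + 1\<close>.
  Pascal's rule splits those of rank \<open>2t + 2\<close> into \<open>odd_rank_count q m t\<close>
  and a multiple of the number in dimension \<open>m\<close>, and the latter is the sum of the
  hyperbolic and elliptic counts.\<close>

lemma zero_enum_const:
  assumes q: "q \<ge> 2"
  shows "zero_enum q m (\<lambda>_. 1) = of_nat q ^ (m * (m + 1) div 2)"
proof -
  define a where "a k t = gauss_binomial q k (2 * t) * alternating_count q t" for k t
  have a1: "a (Suc m) (Suc t)
      = odd_rank_count q m t + of_nat q ^ (2 * Suc t) * a m (Suc t)" for t
    using gauss_binomial_pascal[OF q, of m "2 * t + 1"]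
    by (simp add: a_def odd_rank_count_def distrib_right mult.assoc del: alternating_count.simps)
  have a2: "even_rank_count q 1 m t + even_rank_count q (-1) m t = of_nat q ^ (2 * t) * a m t" for t
  proof -
    have "1 / 2 * g * R * (R + 1) * A + 1 / 2 * g * R * (R + - 1) * A = R\<^sup>2 * (g * A)" for g R A :: rat
      by (simp add: field_simps power2_eq_square)
    thus ?thesis unfolding even_rank_count_def a_def power_even_eq .
  qed
  have "zero_enum q m (\<lambda>_. 1) = (\<Sum>t\<le>m. odd_rank_count q m t) + (\<Sum>t\<le>m. of_nat q ^ (2 * t) * a m t)"
    by (simp only: zero_enum_def zero_enum_term_def add.assoc a2 mult_1_right sum.distrib)
  also have "(\<Sum>t\<le>m. of_nat q ^ (2 * t) * a m t) = (\<Sum>t\<le>Suc m. of_nat q ^ (2 * t) * a m t)"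
    by (simp add: a_def gauss_binomial_eq_0)
  also have "\<dots> = a (Suc m) 0 + (\<Sum>t\<le>m. of_nat q ^ (2 * Suc t) * a m (Suc t))"
    by (subst sum.atMost_Suc_shift) (simp add: a_def)
  also have "(\<Sum>t\<le>m. odd_rank_count q m t) + \<dots> = (\<Sum>t\<le>Suc m. a (Suc m) t)"
    by (simp only: sum.atMost_Suc_shift a1 sum.distrib add_ac)
  finally show ?thesis
    using sum_alternating_count[OF q, of "Suc m"] by (simp add: a_def mult.commute)
qed

lemma zero_enum_linear:
  "zero_enum q m (\<lambda>\<zeta>. c + \<psi> \<zeta>) = c * zero_enum q m (\<lambda>_. 1) + zero_enum q m \<psi>"
  unfolding zero_enum_def sum_distrib_left sum.distrib[symmetric]
  by (rule sum.cong[OF refl]) (simp add: zero_enum_term_def algebra_simps)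

section \<open>Quadratic forms on subspaces of a vector space over a finite field\<close>

locale finite_field_space = vector_space scale
  for scale :: "'a::{field,finite} \<Rightarrow> 'b::ab_group_add \<Rightarrow> 'b" (infixr \<open>*s\<close> 75)
begin

text \<open>Forms on \<open>V\<close> are functions on the whole type, set to 0 outside
  \<open>V\<close>, so that each form is represented once and the forms on a finite \<open>V\<close>
  can be counted.\<close>

definition linear_forms :: "'b set \<Rightarrow> ('b \<Rightarrow> 'a) set" where
  "linear_forms V = {l. (\<forall>x. x \<notin> V \<longrightarrow> l x = 0) \<and> (\<forall>x\<in>V. \<forall>y\<in>V. l (x + y) = l x + l y) \<and>
     (\<forall>c. \<forall>x\<in>V. l (c *s x) = c * l x)}"

definition polar :: "('b \<Rightarrow> 'a) \<Rightarrow> 'b \<Rightarrow> 'b \<Rightarrow> 'a" where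
  "polar f x y = f (x + y) - f x - f y"

text \<open>The definition through the polar form is valid in every characteristic. Linearity in one
  argument suffices since the polar form is symmetric.\<close>

definition quadratic_forms :: "'b set \<Rightarrow> ('b \<Rightarrow> 'a) set" where
  "quadratic_forms V = {f. (\<forall>x. x \<notin> V \<longrightarrow> f x = 0) \<and> (\<forall>c. \<forall>x\<in>V. f (c *s x) = c\<^sup>2 * f x) \<and>
     (\<forall>x\<in>V. \<forall>y\<in>V. \<forall>z\<in>V. polar f (x + y) z = polar f x z + polar f y z) \<and>
     (\<forall>c. \<forall>x\<in>V. \<forall>y\<in>V. polar f (c *s x) y = c * polar f x y)}"

definition zeros :: "'b set \<Rightarrow> ('b \<Rightarrow> 'a) \<Rightarrow> nat" where
  "zeros V f = card {x \<in> V. f x = 0}"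

definition restr :: "'b set \<Rightarrow> ('b \<Rightarrow> 'a) \<Rightarrow> 'b \<Rightarrow> 'a" where
  "restr U f x = (if x \<in> U then f x else 0)"

lemma polar_commute: "polar f x y = polar f y x"
  by (simp add: polar_def add.commute)

lemma linear_formsD:
  assumes "l \<in> linear_forms V"
  shows "x \<notin> V \<Longrightarrow> l x = 0" "x \<in> V \<Longrightarrow> y \<in> V \<Longrightarrow> l (x + y) = l x + l y"
    "x \<in> V \<Longrightarrow> l (c *s x) = c * l x"
  using assms by (auto simp: linear_forms_def)

lemma linear_forms_0: "subspace V \<Longrightarrow> l \<in> linear_forms V \<Longrightarrow> l 0 = 0"
  using linear_formsD(3)[of l V 0 0] subspace_0 by simp

lemma quadratic_formsD:
  assumes "f \<in> quadratic_forms V"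
  shows "x \<notin> V \<Longrightarrow> f x = 0" "x \<in> V \<Longrightarrow> f (c *s x) = c\<^sup>2 * f x"
    "x \<in> V \<Longrightarrow> y \<in> V \<Longrightarrow> z \<in> V \<Longrightarrow> polar f (x + y) z = polar f x z + polar f y z"
    "x \<in> V \<Longrightarrow> y \<in> V \<Longrightarrow> polar f (c *s x) y = c * polar f x y"
  using assms by (auto simp: quadratic_forms_def)

lemma quadratic_forms_0: "subspace V \<Longrightarrow> f \<in> quadratic_forms V \<Longrightarrow> f 0 = 0"
  using quadratic_formsD(2)[of f V 0 0] subspace_0 by simp

lemma finite_linear_forms: "finite V \<Longrightarrow> finite (linear_forms V)"
  by (rule finite_subset[OF _ finite_set_of_finite_funs[of V UNIV 0]])
    (auto simp: linear_forms_def)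

lemma finite_quadratic_forms: "finite V \<Longrightarrow> finite (quadratic_forms V)"
  by (rule finite_subset[OF _ finite_set_of_finite_funs[of V UNIV 0]])
    (auto simp: quadratic_forms_def)

lemma restr_linear_forms:
  assumes "subspace U" "U \<subseteq> V" "l \<in> linear_forms V"
  shows "restr U l \<in> linear_forms U"
proof -
  note [simp] = subspace_add[OF assms(1)] subspace_scale[OF assms(1)] subsetD[OF assms(2)]
    linear_formsD[OF assms(3)]
  show ?thesis by (simp add: linear_forms_def restr_def)
qed

lemma restr_quadratic_forms:
  assumes "subspace U" "U \<subseteq> V" "f \<in> quadratic_forms V"
  shows "restr U f \<in> quadratic_forms U"
proof -
  note [simp] = subspace_add[OF assms(1)] subspace_scale[OF assms(1)] subsetD[OF assms(2)]
    quadratic_formsD(2)[OF assms(3)]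
  have "polar (restr U f) x y = polar f x y" if "x \<in> U" "y \<in> U" for x y
    using that by (simp add: polar_def restr_def)
  thus ?thesis
    by (simp add: quadratic_forms_def quadratic_formsD(3,4)[OF assms(3)]) (simp add: restr_def)
qed

lemma ex_linear_form_eq_1:
  assumes "subspace V" "v \<in> V" "v \<noteq> 0"
  obtains t where "t \<in> linear_forms V" "t v = 1"
proof -
  interpret p: vector_space_pair scale "(*) :: 'a \<Rightarrow> 'a \<Rightarrow> 'a"
    by unfold_locales (simp_all add: algebra_simps)
  have "independent {v}" using assms(3) by simp
  then obtain g where g: "Vector_Spaces.linear scale (*) g" "\<forall>x\<in>{v}. g x = 1"
    using p.linear_independent_extend[of "{v}" "\<lambda>_. 1"] by blast
  interpret g: Vector_Spaces.linear scale "(*)" g by (rule g(1))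
  have "g \<in> linear_forms UNIV"
    by (simp add: linear_forms_def g.add g.scale)
  hence "restr V g \<in> linear_forms V"
    using assms(1) by (intro restr_linear_forms[of V UNIV]) auto
  moreover have "restr V g v = 1" using g(2) assms(2) by (simp add: restr_def)
  ultimately show thesis by (rule that)
qed

end

section \<open>Splitting a space into a hyperplane and a line\<close>

text \<open>The complement \<open>U\<close> of the line through \<open>v\<close> is given as the
  kernel of a functional with value 1 at \<open>v\<close>, so that \<open>t\<close> is the
  coordinate along \<open>v\<close> and \<open>pr\<close> the projection to \<open>U\<close>. The
  locale is used again one dimension lower, for the kernel of \<open>l\<close> in
  \<open>U\<close>.\<close>

locale hyperplane = finite_field_space scale
  for scale :: "'a::{field,finite} \<Rightarrow> 'b::ab_group_add \<Rightarrow> 'b" (infixr \<open>*s\<close> 75) +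
  fixes V U :: "'b set" and t :: "'b \<Rightarrow> 'a" and v :: 'b
  assumes subspace_V: "subspace V" and finite_V: "finite V"
    and t: "t \<in> linear_forms V" and v_in: "v \<in> V" and t_v: "t v = 1"
    and U_eq: "U = {x \<in> V. t x = 0}"
begin

definition pr :: "'b \<Rightarrow> 'b" where
  "pr x = x - t x *s v"

lemmas t_simps = linear_formsD(2,3)[OF t] linear_forms_0[OF subspace_V t] t_v
lemmas V_closed = v_in subspace_0[OF subspace_V] subspace_add[OF subspace_V]
  subspace_scale[OF subspace_V] subspace_diff[OF subspace_V]

lemma t_diff: "x \<in> V \<Longrightarrow> y \<in> V \<Longrightarrow> t (x - y) = t x - t y"
  using t_simps(1)[of "x - y" y] by (simp add: V_closed)

lemma U_subset: "U \<subseteq> V"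
  by (auto simp: U_eq)

lemma subspace_U: "subspace U"
  unfolding subspace_def by (auto simp: U_eq t_simps V_closed)

lemma pr_in: "x \<in> V \<Longrightarrow> pr x \<in> U"
  by (simp add: U_eq pr_def t_diff t_simps V_closed)

lemma pr_add: "x \<in> V \<Longrightarrow> y \<in> V \<Longrightarrow> pr (x + y) = pr x + pr y"
  by (simp add: pr_def t_simps scale_left_distrib)

lemma pr_scale: "x \<in> V \<Longrightarrow> pr (c *s x) = c *s pr x"
  by (simp add: pr_def t_simps scale_right_diff_distrib)

lemma pr_U: "u \<in> U \<Longrightarrow> pr u = u" and t_U: "u \<in> U \<Longrightarrow> t u = 0"
  by (simp_all add: pr_def U_eq)

lemma pr_v: "pr v = 0"
  by (simp add: pr_def t_v)

lemma pr_decomp: "pr x + t x *s v = x"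
  by (simp add: pr_def)

lemma bij_betw_decomp: "bij_betw (\<lambda>(u, c). u + c *s v) (U \<times> UNIV) V"
  using U_subset
  by (intro bij_betw_byWitness[where f' = "\<lambda>x. (pr x, t x)"])
    (auto simp: pr_decomp pr_add pr_U pr_scale pr_v t_U t_simps V_closed pr_in subset_iff)

lemma finite_U: "finite U"
  using U_subset finite_V by (rule finite_subset)

lemma card_V: "card V = card U * CARD('a)"
  using bij_betw_same_card[OF bij_betw_decomp] by (simp add: card_cartesian_product)

definition glue_linear :: "('b \<Rightarrow> 'a) \<Rightarrow> 'a \<Rightarrow> 'b \<Rightarrow> 'a" where
  "glue_linear l c x = (if x \<in> V then l (pr x) + c * t x else 0)"

text \<open>The general form on \<open>V\<close> in these coordinates: \<open>g\<close> is its
  restriction to \<open>U\<close>, \<open>l\<close> its polar form with \<open>v\<close>, and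
  \<open>c\<close> its value at \<open>v\<close>. Forms vanishing at \<open>v\<close> are those with
  \<open>c = 0\<close>.\<close>

definition glue_quadratic :: "('b \<Rightarrow> 'a) \<Rightarrow> ('b \<Rightarrow> 'a) \<Rightarrow> 'a \<Rightarrow> 'b \<Rightarrow> 'a" where
  "glue_quadratic g l c x = (if x \<in> V then g (pr x) + t x * l (pr x) + c * (t x)\<^sup>2 else 0)"

lemma glue_linear_in: "l \<in> linear_forms U \<Longrightarrow> glue_linear l c \<in> linear_forms V"
  by (simp add: linear_forms_def[of V] glue_linear_def V_closed t_simps pr_add pr_scale pr_in
      linear_formsD algebra_simps)

lemma bij_betw_glue_linear:
  "bij_betw (\<lambda>(l, c). glue_linear l c) (linear_forms U \<times> UNIV) (linear_forms V)"
proof (rule bij_betw_byWitness[where f' = "\<lambda>l. (restr U l, l v)"])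
  have "restr U (glue_linear l c) = l \<and> glue_linear l c v = c" if l: "l \<in> linear_forms U" for l c
  proof
    show "restr U (glue_linear l c) = l"
      using U_subset by (auto simp: fun_eq_iff restr_def glue_linear_def pr_U t_U linear_formsD(1)[OF l])
    show "glue_linear l c v = c"
      using linear_forms_0[OF subspace_U l] by (simp add: glue_linear_def v_in pr_v t_v)
  qed
  thus "\<forall>p\<in>linear_forms U \<times> UNIV. (\<lambda>l. (restr U l, l v)) (case p of (l, c) \<Rightarrow> glue_linear l c) = p"
    by auto
  have "glue_linear (restr U l) (l v) x = l x" if l: "l \<in> linear_forms V" for l x
  proof (cases "x \<in> V")
    case True
    have "l (pr x + t x *s v) = l (pr x) + t x * l v"
      using True pr_in[OF True] U_subset by (simp add: linear_formsD[OF l] V_closed subset_iff)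
    thus ?thesis using True by (simp add: glue_linear_def restr_def pr_in pr_decomp)
  qed (simp add: glue_linear_def linear_formsD(1)[OF l])
  thus "\<forall>l\<in>linear_forms V. (case (restr U l, l v) of (l, c) \<Rightarrow> glue_linear l c) = l"
    by auto
  show "(\<lambda>(l, c). glue_linear l c) ` (linear_forms U \<times> UNIV) \<subseteq> linear_forms V"
    by (auto simp: glue_linear_in)
  show "(\<lambda>l. (restr U l, l v)) ` linear_forms V \<subseteq> linear_forms U \<times> UNIV"
    by (auto intro: restr_linear_forms[OF subspace_U U_subset])
qed

lemma polar_glue_quadratic:
  assumes "g \<in> quadratic_forms U" "l \<in> linear_forms U" "x \<in> V" "y \<in> V"
  shows "polar (glue_quadratic g l c) x y
    = polar g (pr x) (pr y) + t x * l (pr y) + t y * l (pr x) + 2 * c * t x * t y"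
  using assms(3,4)
  by (simp add: polar_def glue_quadratic_def V_closed pr_add t_simps linear_formsD(2)[OF assms(2)]
      pr_in algebra_simps power2_eq_square)

lemma glue_quadratic_in:
  assumes g: "g \<in> quadratic_forms U" and l: "l \<in> linear_forms U"
  shows "glue_quadratic g l c \<in> quadratic_forms V"
proof -
  have "glue_quadratic g l c (a *s x) = a\<^sup>2 * glue_quadratic g l c x" if "x \<in> V" for a x
    using that by (simp add: glue_quadratic_def V_closed pr_scale t_simps pr_in linear_formsD[OF l]
        quadratic_formsD(2)[OF g] algebra_simps power2_eq_square)
  thus ?thesis
    by (simp add: quadratic_forms_def[of V] polar_glue_quadratic[OF g l] V_closed pr_add pr_scale
        t_simps pr_in linear_formsD[OF l] quadratic_formsD(3,4)[OF g] algebra_simps)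
      (simp add: glue_quadratic_def)
qed

lemma restr_glue_quadratic:
  assumes g: "g \<in> quadratic_forms U" and l: "l \<in> linear_forms U"
  shows "restr U (glue_quadratic g l c) = g"
  using U_subset linear_formsD(1)[OF l] quadratic_formsD(1)[OF g]
  by (auto simp: fun_eq_iff restr_def glue_quadratic_def pr_U t_U)

lemma glue_quadratic_v:
  assumes g: "g \<in> quadratic_forms U" and l: "l \<in> linear_forms U"
  shows "glue_quadratic g l c v = c"
  using linear_forms_0[OF subspace_U l] quadratic_forms_0[OF subspace_U g]
  by (simp add: glue_quadratic_def v_in pr_v t_v)

lemma bij_betw_glue_quadratic:
  "bij_betw (\<lambda>(g, l, c). glue_quadratic g l c)
     (quadratic_forms U \<times> linear_forms U \<times> UNIV) (quadratic_forms V)"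
proof (rule bij_betw_byWitness[where f' = "\<lambda>f. (restr U f, restr U (\<lambda>u. polar f u v), f v)"])
  have "restr U (\<lambda>u. polar (glue_quadratic g l c) u v) = l"
    if g: "g \<in> quadratic_forms U" and l: "l \<in> linear_forms U" for g l c
  proof
    fix u
    show "restr U (\<lambda>u. polar (glue_quadratic g l c) u v) u = l u"
    proof (cases "u \<in> U")
      case True
      hence u: "u \<in> V" using U_subset by auto
      show ?thesis using True quadratic_forms_0[OF subspace_U g] linear_forms_0[OF subspace_U l]
        by (simp add: restr_def polar_glue_quadratic[OF g l u v_in] pr_U t_U pr_v t_v)
          (simp add: polar_def)
    qed (simp add: restr_def linear_formsD(1)[OF l])
  qed
  thus "\<forall>p\<in>quadratic_forms U \<times> linear_forms U \<times> UNIV.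
      (\<lambda>f. (restr U f, restr U (\<lambda>u. polar f u v), f v)) (case p of (g, l, c) \<Rightarrow> glue_quadratic g l c) = p"
    by (auto simp: restr_glue_quadratic glue_quadratic_v)
  have "glue_quadratic (restr U f) (restr U (\<lambda>u. polar f u v)) (f v) x = f x"
    if f: "f \<in> quadratic_forms V" for f x
  proof (cases "x \<in> V")
    case True
    hence prx: "pr x \<in> V" using pr_in U_subset by auto
    have "f (pr x + t x *s v) = f (pr x) + f (t x *s v) + polar f (t x *s v) (pr x)"
      by (simp add: polar_def add.commute)
    also have "polar f (t x *s v) (pr x) = t x * polar f (pr x) v"
      using prx by (simp add: quadratic_formsD(4)[OF f] v_in polar_commute[of f v])
    finally show ?thesis using True
      by (simp add: glue_quadratic_def restr_def pr_in pr_decomp quadratic_formsD(2)[OF f] v_in)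
  qed (simp add: glue_quadratic_def quadratic_formsD(1)[OF f])
  thus "\<forall>f\<in>quadratic_forms V. (case (restr U f, restr U (\<lambda>u. polar f u v), f v) of
      (g, l, c) \<Rightarrow> glue_quadratic g l c) = f"
    by auto
  show "(\<lambda>(g, l, c). glue_quadratic g l c) ` (quadratic_forms U \<times> linear_forms U \<times> UNIV)
      \<subseteq> quadratic_forms V"
    by (auto simp: glue_quadratic_in)
  have "restr U (\<lambda>u. polar f u v) \<in> linear_forms U" if f: "f \<in> quadratic_forms V" for f
    using U_subset subspace_add[OF subspace_U] subspace_scale[OF subspace_U]
    by (simp add: linear_forms_def restr_def quadratic_formsD(3,4)[OF f] v_in subset_iff)
  thus "(\<lambda>f. (restr U f, restr U (\<lambda>u. polar f u v), f v)) ` quadratic_forms V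
      \<subseteq> quadratic_forms U \<times> linear_forms U \<times> UNIV"
    by (auto intro: restr_quadratic_forms[OF subspace_U U_subset])
qed

text \<open>On the coset \<open>u + c v\<close> with \<open>u\<close> fixed, the form is
  \<open>g u + c * l u\<close>, affine in \<open>c\<close>: it has one root if \<open>l u\<close> is
  nonzero, and otherwise it vanishes for all \<open>c\<close> or for none.\<close>

lemma zeros_glue_quadratic:
  "zeros V (glue_quadratic g l 0)
    = card {u \<in> U. l u \<noteq> 0} + CARD('a) * card {u \<in> U. l u = 0 \<and> g u = 0}"
proof -
  have val: "glue_quadratic g l 0 (u + c *s v) = g u + c * l u" if "u \<in> U" for u c
    using that U_subset
    by (auto simp: glue_quadratic_def V_closed pr_add pr_scale pr_U pr_v t_simps t_U)
  have "bij_betw (\<lambda>(u, c). u + c *s v) (SIGMA u:U. {c. g u + c * l u = 0})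
      {x \<in> V. glue_quadratic g l 0 x = 0}"
  proof (rule bij_betw_subset[OF bij_betw_decomp])
    show "(\<lambda>(u, c). u + c *s v) ` (SIGMA u:U. {c. g u + c * l u = 0})
        = {x \<in> V. glue_quadratic g l 0 x = 0}" (is "?L = ?R")
    proof
      show "?L \<subseteq> ?R" using U_subset by (auto simp: val V_closed)
      show "?R \<subseteq> ?L"
      proof
        fix x assume x: "x \<in> ?R"
        hence "(pr x, t x) \<in> (SIGMA u:U. {c. g u + c * l u = 0})"
          using val[of "pr x" "t x"] by (auto simp: pr_in pr_decomp)
        thus "x \<in> ?L" by (rule rev_image_eqI) (simp add: pr_decomp)
      qed
    qed
  qed auto
  hence "zeros V (glue_quadratic g l 0) = card (SIGMA u:U. {c. g u + c * l u = 0})"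
    unfolding zeros_def by (simp add: bij_betw_same_card)
  also have "\<dots> = (\<Sum>u\<in>U. card {c. g u + c * l u = 0})"
    using finite_U by (subst card_SigmaI) auto
  also have "\<dots> = (\<Sum>u\<in>U. (if l u \<noteq> 0 then 1 else 0)
      + CARD('a) * (if l u = 0 \<and> g u = 0 then 1 else 0))"
  proof (rule sum.cong[OF refl])
    fix u assume "u \<in> U"
    show "card {c. g u + c * l u = 0}
      = (if l u \<noteq> 0 then 1 else 0) + CARD('a) * (if l u = 0 \<and> g u = 0 then 1 else 0)"
    proof (cases "l u = 0")
      case False
      hence "{c. g u + c * l u = 0} = {- g u / l u}"
        by (auto simp: field_simps add_eq_0_iff)
      thus ?thesis using False by simp
    qed auto
  qed
  also have "\<dots> = card {u \<in> U. l u \<noteq> 0} + CARD('a) * card {u \<in> U. l u = 0 \<and> g u = 0}"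
  proof -
    have "(\<Sum>u\<in>U. if R u then 1 else 0) = card {u \<in> U. R u}" for R
      using finite_U by (simp flip: sum.inter_filter)
    thus ?thesis by (simp only: sum.distrib flip: sum_distrib_left)
  qed
  finally show ?thesis .
qed

lemma sum_quadratic_forms_vanishing:
  fixes \<psi> :: "('b \<Rightarrow> 'a) \<Rightarrow> rat"
  shows "(\<Sum>f\<in>quadratic_forms V. if f v = 0 then \<psi> f else 0)
    = (\<Sum>l\<in>linear_forms U. \<Sum>g\<in>quadratic_forms U. \<psi> (glue_quadratic g l 0))"
proof -
  have "(\<Sum>f\<in>quadratic_forms V. if f v = 0 then \<psi> f else 0)
      = (\<Sum>(g, l, c)\<in>quadratic_forms U \<times> linear_forms U \<times> UNIV.
          if c = 0 then \<psi> (glue_quadratic g l c) else 0)"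
    by (subst sum.reindex_bij_betw[OF bij_betw_glue_quadratic, symmetric])
      (auto intro!: sum.cong simp: glue_quadratic_v)
  also have "\<dots> = (\<Sum>g\<in>quadratic_forms U. \<Sum>l\<in>linear_forms U. \<psi> (glue_quadratic g l 0))"
    by (simp flip: sum.cartesian_product)
  finally show ?thesis by (simp only: sum.swap[of _ "quadratic_forms U"])
qed

text \<open>Each form on \<open>U\<close> has one extension to \<open>V\<close> for every choice of
  \<open>l\<close> and \<open>c\<close>.\<close>

lemma sum_quadratic_forms_restr:
  fixes \<psi> :: "('b \<Rightarrow> 'a) \<Rightarrow> rat"
  shows "(\<Sum>f\<in>quadratic_forms V. \<psi> (restr U f))
    = of_nat (card (linear_forms U) * CARD('a)) * (\<Sum>g\<in>quadratic_forms U. \<psi> g)"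
proof -
  have "(\<Sum>f\<in>quadratic_forms V. \<psi> (restr U f))
      = (\<Sum>(g, l, c)\<in>quadratic_forms U \<times> linear_forms U \<times> (UNIV :: 'a set). \<psi> g)"
    by (subst sum.reindex_bij_betw[OF bij_betw_glue_quadratic, symmetric])
      (auto intro!: sum.cong simp: restr_glue_quadratic)
  thus ?thesis by (simp add: card_cartesian_product mult_ac flip: sum.cartesian_product sum_distrib_right)
qed

end

section \<open>The distribution of zeros over all quadratic forms\<close>

lemma two_le_card_field: "2 \<le> CARD('a::{field,finite})"
  using card_mono[of UNIV "{0, 1 :: 'a}"] by simp

context finite_field_space
begin

lemma ex_hyperplane:
  assumes "subspace V" "card V = CARD('a) ^ Suc m" "v \<in> V" "v \<noteq> 0"
  obtains t U where "hyperplane scale V U t v" "card U = CARD('a) ^ m"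
proof -
  obtain t where t: "t \<in> linear_forms V" "t v = 1"
    using ex_linear_form_eq_1 assms by blast
  have "finite V" using assms(2) card_ge_0_finite[of V] by simp
  then interpret hyperplane scale V "{x \<in> V. t x = 0}" t v
    using assms t by unfold_locales auto
  show thesis
    using card_V assms(2) by (intro that[OF hyperplane_axioms]) simp
qed

lemma card_eq_1_subspace:
  assumes "subspace V" "card V = 1"
  shows "V = {0}"
  using assms subspace_0[of V] by (auto simp: card_1_singleton_iff)

lemma ex_nonzero:
  assumes "subspace V" "card V = CARD('a) ^ Suc m"
  obtains v where "v \<in> V" "v \<noteq> 0"
proof -
  have "card V > 1" unfolding assms(2)
    using two_le_card_field[where 'a = 'a] by (intro one_less_power) auto
  hence "V \<noteq> {0}" by auto
  thus thesis using subspace_0[OF assms(1)] that by auto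
qed

lemma card_linear_forms:
  assumes "subspace V" "card V = CARD('a) ^ m"
  shows "card (linear_forms V) = CARD('a) ^ m"
  using assms
proof (induction m arbitrary: V)
  case 0
  hence V: "V = {0}" using card_eq_1_subspace by simp
  have "linear_forms V = {\<lambda>_. 0}"
  proof
    show "linear_forms V \<subseteq> {\<lambda>_. 0}"
    proof
      fix l assume l: "l \<in> linear_forms V"
      have "l x = 0" for x
        using linear_formsD(1)[OF l] linear_forms_0[OF 0(1) l] V by (cases "x = 0") auto
      thus "l \<in> {\<lambda>_. 0}" by auto
    qed
  qed (auto simp: linear_forms_def)
  thus ?case by simp
next
  case (Suc m)
  obtain v where v: "v \<in> V" "v \<noteq> 0" using ex_nonzero[OF Suc.prems] .
  obtain t U where h: "hyperplane scale V U t v" and U: "card U = CARD('a) ^ m"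
    using ex_hyperplane[OF Suc.prems v] .
  interpret hyperplane scale V U t v by (rule h)
  show ?case
    using bij_betw_same_card[OF bij_betw_glue_linear] Suc.IH[OF subspace_U U]
    by (simp add: card_cartesian_product mult.commute)
qed

text \<open>Each new dimension brings \<open>q^m\<close> choices for the polar form with
  \<open>v\<close> and \<open>q\<close> for the value at \<open>v\<close>, so the exponent grows by
  \<open>m + 1\<close>.\<close>

lemma card_quadratic_forms:
  assumes "subspace V" "card V = CARD('a) ^ m"
  shows "card (quadratic_forms V) = CARD('a) ^ (m * (m + 1) div 2)"
  using assms
proof (induction m arbitrary: V)
  case 0
  hence V: "V = {0}" using card_eq_1_subspace by simp
  have "quadratic_forms V = {\<lambda>_. 0}"
  proof
    show "quadratic_forms V \<subseteq> {\<lambda>_. 0}"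
    proof
      fix l assume l: "l \<in> quadratic_forms V"
      have "l x = 0" for x
        using quadratic_formsD(1)[OF l] quadratic_forms_0[OF 0(1) l] V by (cases "x = 0") auto
      thus "l \<in> {\<lambda>_. 0}" by auto
    qed
  qed (auto simp: quadratic_forms_def polar_def)
  thus ?case by simp
next
  case (Suc m)
  obtain v where v: "v \<in> V" "v \<noteq> 0" using ex_nonzero[OF Suc.prems] .
  obtain t U where h: "hyperplane scale V U t v" and U: "card U = CARD('a) ^ m"
    using ex_hyperplane[OF Suc.prems v] .
  interpret hyperplane scale V U t v by (rule h)
  have "card (quadratic_forms V) = CARD('a) ^ (m * (m + 1) div 2 + Suc m)"
    using bij_betw_same_card[OF bij_betw_glue_quadratic] Suc.IH[OF subspace_U U]
      card_linear_forms[OF subspace_U U]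
    by (simp add: card_cartesian_product power_add mult_ac)
  also have "m * (m + 1) div 2 + Suc m = Suc m * (Suc m + 1) div 2" by simp
  finally show ?case .
qed

text \<open>The inductive claim enters as the premise \<open>IH\<close>, which is applied to
  \<open>U\<close> when \<open>l = 0\<close> and to the kernel of \<open>l\<close>, of dimension
  \<open>m - 1\<close>, otherwise. The result does not depend on \<open>v\<close>, nor does the
  contribution of a nonzero \<open>l\<close> depend on \<open>l\<close>.\<close>

lemma sum_vanishing_at_point:
  assumes V: "subspace V" "card V = CARD('a) ^ Suc m" and v: "v \<in> V" "v \<noteq> 0"
    and IH: "\<And>k U \<psi>. k \<le> m \<Longrightarrow> subspace U \<Longrightarrow> card U = CARD('a) ^ k \<Longrightarrow>
      (\<Sum>f\<in>quadratic_forms U. \<psi> (of_nat (zeros U f))) = zero_enum CARD('a) k \<psi>"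
  shows "(\<Sum>f\<in>quadratic_forms V. if f v = 0 then \<psi> (of_nat (zeros V f)) else 0)
    = zero_enum CARD('a) m (\<lambda>\<zeta>. \<psi> (of_nat CARD('a) * \<zeta>))
      + (of_nat CARD('a) ^ m - 1) * of_nat CARD('a) ^ m
        * zero_enum CARD('a) (m - 1)
            (\<lambda>\<zeta>. \<psi> (of_nat CARD('a) ^ m - of_nat CARD('a) ^ (m - 1) + of_nat CARD('a) * \<zeta>))"
proof -
  define q where "q = CARD('a)"
  obtain t U where h: "hyperplane scale V U t v" and U: "card U = CARD('a) ^ m"
    using ex_hyperplane[OF V v] .
  interpret hyperplane scale V U t v by (rule h)
  define S where "S l = (\<Sum>g\<in>quadratic_forms U. \<psi> (of_nat (zeros V (glue_quadratic g l 0))))" for l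
  define Z where "Z = zero_enum q (m - 1)
    (\<lambda>\<zeta>. \<psi> (of_nat q ^ m - of_nat q ^ (m - 1) + of_nat q * \<zeta>))"
  have S0: "S (\<lambda>_. 0) = zero_enum q m (\<lambda>\<zeta>. \<psi> (of_nat q * \<zeta>))"
    unfolding S_def zeros_glue_quadratic
    using IH[OF order_refl subspace_U U, of "\<lambda>\<zeta>. \<psi> (of_nat q * \<zeta>)"]
    by (simp add: zeros_def q_def)
  have S1: "S l = of_nat q ^ m * Z" if l: "l \<in> linear_forms U" "l \<noteq> (\<lambda>_. 0)" for l
  proof -
    obtain w where w: "l w \<noteq> 0" using l(2) by auto
    hence wU: "w \<in> U" using linear_formsD(1)[OF l(1)] by auto
    have m: "m \<noteq> 0"
    proof
      assume "m = 0"
      hence "U = {0}" using card_eq_1_subspace[OF subspace_U] U by simp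
      thus False using w wU linear_forms_0[OF subspace_U l(1)] by auto
    qed
    \<comment> \<open>Scaling makes the functional take the value 1 at \<open>w\<close>, as the
      locale demands; its kernel is that of \<open>l\<close>.\<close>
    define s where "s x = l x / l w" for x
    define K where "K = {x \<in> U. l x = 0}"
    interpret K: hyperplane scale U K s w
      by unfold_locales
        (use w wU subspace_U finite_U in \<open>auto simp: K_def s_def linear_forms_def linear_formsD[OF l(1)] add_divide_distrib\<close>)
    have "CARD('a) ^ m = card K * CARD('a)" using K.card_V U by simp
    hence cK: "card K = CARD('a) ^ (m - 1)" using m by (cases m) auto
    have "{u \<in> U. l u \<noteq> 0} = U - K" by (auto simp: K_def)
    hence "card {u \<in> U. l u \<noteq> 0} = q ^ m - q ^ (m - 1)"
      using card_Diff_subset[OF K.finite_U K.U_subset] cK U by (simp add: q_def)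
    moreover have "q ^ (m - 1) \<le> q ^ m"
      by (rule power_increasing) (simp_all add: q_def Suc_leI)
    ultimately have c: "of_nat (card {u \<in> U. l u \<noteq> 0}) = (of_nat q ^ m - of_nat q ^ (m - 1) :: rat)"
      by simp
    have z: "card {u \<in> U. l u = 0 \<and> g u = 0} = zeros K (restr K g)" for g
      unfolding zeros_def by (rule arg_cong[where f = card]) (auto simp: K_def restr_def)
    have "S l = (\<Sum>g\<in>quadratic_forms U. \<psi> (of_nat q ^ m - of_nat q ^ (m - 1)
        + of_nat q * of_nat (zeros K (restr K g))))"
      unfolding S_def zeros_glue_quadratic z by (simp add: c q_def[symmetric])
    also have "\<dots> = of_nat (card (linear_forms K) * CARD('a)) * (\<Sum>g\<in>quadratic_forms K.
        \<psi> (of_nat q ^ m - of_nat q ^ (m - 1) + of_nat q * of_nat (zeros K g)))"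
      by (rule K.sum_quadratic_forms_restr)
    also have "(\<Sum>g\<in>quadratic_forms K.
        \<psi> (of_nat q ^ m - of_nat q ^ (m - 1) + of_nat q * of_nat (zeros K g))) = Z"
      unfolding Z_def q_def by (rule IH[OF _ K.subspace_U cK]) simp
    \<comment> \<open>The number of extensions of a form from \<open>K\<close> to \<open>U\<close>:
      \<open>q^(m-1)\<close> polar forms times \<open>q\<close> values at \<open>w\<close>.\<close>
    also have "card (linear_forms K) * CARD('a) = q ^ m"
      using card_linear_forms[OF K.subspace_U cK] m by (cases m) (simp_all add: q_def)
    finally show ?thesis by simp
  qed
  have zin: "(\<lambda>_. 0) \<in> linear_forms U" by (simp add: linear_forms_def)
  have "(\<Sum>f\<in>quadratic_forms V. if f v = 0 then \<psi> (of_nat (zeros V f)) else 0)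
      = (\<Sum>l\<in>linear_forms U. S l)"
    unfolding S_def by (rule sum_quadratic_forms_vanishing)
  also have "\<dots> = S (\<lambda>_. 0) + (\<Sum>l\<in>linear_forms U - {\<lambda>_. 0}. S l)"
    by (rule sum.remove[OF finite_linear_forms[OF finite_U] zin])
  also have "(\<Sum>l\<in>linear_forms U - {\<lambda>_. 0}. S l) = (of_nat q ^ m - 1) * (of_nat q ^ m * Z)"
  proof -
    have "card (linear_forms U - {\<lambda>_. 0}) = q ^ m - 1"
      using card_linear_forms[OF subspace_U U] zin by (simp add: q_def)
    hence "of_nat (card (linear_forms U - {\<lambda>_. 0})) = (of_nat q ^ m - 1 :: rat)"
      by (simp add: q_def Suc_leI)
    thus ?thesis by (simp add: S1)
  qed
  finally show ?thesis unfolding S0 Z_def q_def by (simp only: mult.assoc)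
qed

text \<open>The weighted count does not see the forms with \<open>\<zeta> = 1\<close>; writing \<open>\<phi> \<zeta> = \<phi> 1 + (\<zeta> - 1) * \<psi> \<zeta>\<close>
  covers them by the total number of forms.\<close>

theorem sum_quadratic_forms_zeros:
  assumes "subspace V" "card V = CARD('a) ^ m"
  shows "(\<Sum>f\<in>quadratic_forms V. \<phi> (of_nat (zeros V f))) = zero_enum CARD('a) m \<phi>"
  using assms
proof (induction m arbitrary: V \<phi> rule: less_induct)
  case (less m)
  have q: "2 \<le> CARD('a)" by (rule two_le_card_field)
  have V: "subspace V" by (rule less.prems)
  have fin: "finite V" using less.prems(2) card_ge_0_finite[of V] by simp
  \<comment> \<open>At \<zeta> = 1 the quotient is 0 by convention; its value there is irrelevant,
    since \<psi> is multiplied by \<zeta> - 1.\<close>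
  define \<psi> where "\<psi> \<zeta> = (\<phi> \<zeta> - \<phi> 1) / (\<zeta> - 1)" for \<zeta> :: rat
  have \<psi>: "\<phi> \<zeta> = \<phi> 1 + (\<zeta> - 1) * \<psi> \<zeta>" for \<zeta>
    by (cases "\<zeta> = 1") (simp_all add: \<psi>_def)
  have count: "of_nat (zeros V f) - 1 = (\<Sum>v\<in>V - {0}. if f v = 0 then 1 else 0 :: rat)"
    if "f \<in> quadratic_forms V" for f
  proof -
    have "of_nat (zeros V f) = (\<Sum>v\<in>V. if f v = 0 then 1 else 0 :: rat)"
      using fin by (simp add: zeros_def sum.If_cases Int_def)
    also have "\<dots> = 1 + (\<Sum>v\<in>V - {0}. if f v = 0 then 1 else 0)"
      using sum.remove[OF fin subspace_0[OF V], of "\<lambda>v. if f v = 0 then 1 else 0 :: rat"]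
        quadratic_forms_0[OF V that] by simp
    finally show ?thesis by simp
  qed
  have main: "(\<Sum>f\<in>quadratic_forms V. (of_nat (zeros V f) - 1) * \<psi> (of_nat (zeros V f)))
      = zero_enum CARD('a) m (\<lambda>\<zeta>. (\<zeta> - 1) * \<psi> \<zeta>)"
  proof -
    \<comment> \<open>Double counting of the pairs of a form and a nonzero zero of it.\<close>
    have swap: "(\<Sum>f\<in>quadratic_forms V. (of_nat (zeros V f) - 1) * \<psi> (of_nat (zeros V f)))
        = (\<Sum>v\<in>V - {0}. \<Sum>f\<in>quadratic_forms V. if f v = 0 then \<psi> (of_nat (zeros V f)) else 0)"
      by (subst sum.swap, rule sum.cong[OF refl])
        (simp add: count sum_distrib_right if_distrib[where f = "\<lambda>x. x * _"] cong: if_cong)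
    show ?thesis
    proof (cases m)
      case 0
      hence "V = {0}" using card_eq_1_subspace[OF V] less.prems(2) by simp
      thus ?thesis unfolding swap using 0 zero_enum_0[OF q] by simp
    next
      case (Suc k)
      have card: "card V = CARD('a) ^ Suc k" using less.prems(2) Suc by simp
      have IH: "(\<Sum>f\<in>quadratic_forms U. \<chi> (of_nat (zeros U f))) = zero_enum CARD('a) j \<chi>"
        if "j \<le> k" "subspace U" "card U = CARD('a) ^ j" for j U \<chi>
        using less.IH[of j U \<chi>] that Suc by simp
      have "card (V - {0}) = CARD('a) ^ m - 1"
        using less.prems(2) subspace_0[OF V] by simp
      hence "of_nat (card (V - {0})) = (of_nat CARD('a) ^ m - 1 :: rat)"
        by (simp add: Suc_leI)
      thus ?thesis unfolding swap
        by (simp add: sum_vanishing_at_point[OF V card _ _ IH] zero_enum_Suc[OF q] Suc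
            del: power_Suc)
    qed
  qed
  have "(\<Sum>f\<in>quadratic_forms V. \<phi> (of_nat (zeros V f)))
      = (\<Sum>f\<in>quadratic_forms V. \<phi> 1 + (of_nat (zeros V f) - 1) * \<psi> (of_nat (zeros V f)))"
    by (rule sum.cong[OF refl]) (rule \<psi>)
  also have "\<dots> = of_nat (card (quadratic_forms V)) * \<phi> 1
      + zero_enum CARD('a) m (\<lambda>\<zeta>. (\<zeta> - 1) * \<psi> \<zeta>)"
    by (simp add: sum.distrib main)
  also have "\<dots> = zero_enum CARD('a) m (\<lambda>\<zeta>. \<phi> 1 + (\<zeta> - 1) * \<psi> \<zeta>)"
    unfolding zero_enum_linear zero_enum_const[OF q]
    by (simp add: card_quadratic_forms[OF less.prems] mult.commute)
  also have "(\<lambda>\<zeta>. \<phi> 1 + (\<zeta> - 1) * \<psi> \<zeta>) = \<phi>" by (rule ext) (rule \<psi>[symmetric])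
  finally show ?case .
qed

end

section \<open>The Veronese code\<close>

text \<open>The locale needs an abelian group as a type. Since \<open>vec\<close> collects vectors
  of all lengths, those of length \<open>m\<close> are replaced by the functions on the naturals
  that vanish from \<open>m\<close> on.\<close>

definition fun_scale :: "'a::field \<Rightarrow> (nat \<Rightarrow> 'a) \<Rightarrow> nat \<Rightarrow> 'a" where
  "fun_scale c x i = c * x i"

interpretation fun_space: finite_field_space "fun_scale :: 'a::{field,finite} \<Rightarrow> _"
  by unfold_locales (simp_all add: fun_eq_iff fun_scale_def algebra_simps)

definition coord_space :: "nat \<Rightarrow> (nat \<Rightarrow> 'a::field) set" where
  "coord_space m = {x. \<forall>i\<ge>m. x i = 0}"

lemma subspace_coord_space: "fun_space.subspace (coord_space m :: (nat \<Rightarrow> 'a::{field,finite}) set)"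
  by (simp add: fun_space.subspace_def coord_space_def fun_scale_def)

lemma card_coord_space: "card (coord_space m :: (nat \<Rightarrow> 'a::{field,finite}) set) = CARD('a) ^ m"
proof -
  have "bij_betw (\<lambda>x. restrict x {..<m}) (coord_space m :: (nat \<Rightarrow> 'a) set) ({..<m} \<rightarrow>\<^sub>E UNIV)"
    by (rule bij_betw_byWitness[where f' = "\<lambda>x i. if i < m then x i else 0"])
      (auto simp: coord_space_def fun_eq_iff PiE_def extensional_def)
  thus ?thesis using bij_betw_same_card by (fastforce simp: card_PiE)
qed

lemma bij_betw_vec: "bij_betw (vec m) (coord_space m) (carrier_vec m :: 'a::field vec set)"
  by (rule bij_betw_byWitness[where f' = "\<lambda>v i. if i < m then v $ i else 0"])
    (auto simp: coord_space_def fun_eq_iff)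

lemma card_carrier_vec: "card (carrier_vec m :: 'a::{field,finite} vec set) = CARD('a) ^ m"
  using bij_betw_same_card[OF bij_betw_vec[of m, where 'a = 'a]] by (simp add: card_coord_space)

definition veronese_form :: "nat \<Rightarrow> (nat \<Rightarrow> nat \<times> nat) \<Rightarrow> 'a::field vec \<Rightarrow> (nat \<Rightarrow> 'a) \<Rightarrow> 'a" where
  "veronese_form K e a x = (\<Sum>k<K. a $ k * (x (fst (e k)) * x (snd (e k))))"

lemma veronese_form_scale: "veronese_form K e a (fun_scale c x) = c\<^sup>2 * veronese_form K e a x"
  by (simp add: veronese_form_def fun_scale_def sum_distrib_left power2_eq_square mult_ac)

lemma polar_veronese_form:
  "fun_space.polar (veronese_form K e a) x y
    = (\<Sum>k<K. a $ k * (x (fst (e k)) * y (snd (e k)) + y (fst (e k)) * x (snd (e k))))"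
  unfolding fun_space.polar_def veronese_form_def sum_subtractf[symmetric]
  by (rule sum.cong) (simp_all add: algebra_simps)

lemma restr_veronese_form_in:
  "fun_space.restr (coord_space m) (veronese_form K e a)
    \<in> fun_space.quadratic_forms (coord_space m :: (nat \<Rightarrow> 'a::{field,finite}) set)"
proof -
  have "fun_space.polar (veronese_form K e a) (x + y) z
      = fun_space.polar (veronese_form K e a) x z + fun_space.polar (veronese_form K e a) y z" for x y z
    unfolding polar_veronese_form sum.distrib[symmetric]
    by (rule sum.cong) (simp_all add: algebra_simps)
  moreover have "fun_space.polar (veronese_form K e a) (fun_scale c x) y
      = c * fun_space.polar (veronese_form K e a) x y" for c x y
    unfolding polar_veronese_form sum_distrib_left
    by (rule sum.cong) (simp_all add: fun_scale_def algebra_simps)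
  ultimately have "veronese_form K e a \<in> fun_space.quadratic_forms UNIV"
    by (simp add: fun_space.quadratic_forms_def veronese_form_scale)
  thus ?thesis using subspace_coord_space by (intro fun_space.restr_quadratic_forms[of _ UNIV]) auto
qed

text \<open>The coefficients can be read off from the function in every characteristic: that of a
  square is the value at a unit vector, that of a mixed monomial the polar form at two unit
  vectors.\<close>

lemma inj_on_veronese_form:
  assumes e: "monomial_order n K e"
  shows "inj_on (\<lambda>a. fun_space.restr (coord_space (n + 1)) (veronese_form K e a))
    (carrier_vec K :: 'a::{field,finite} vec set)"
proof (rule inj_onI)
  fix a b :: "'a vec"
  assume a: "a \<in> carrier_vec K" and b: "b \<in> carrier_vec K"
    and eq: "fun_space.restr (coord_space (n + 1)) (veronese_form K e a)
      = fun_space.restr (coord_space (n + 1)) (veronese_form K e b)"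
  have eq': "veronese_form K e a x = veronese_form K e b x" if "x \<in> coord_space (n + 1)" for x
    using fun_cong[OF eq, of x] that by (simp add: fun_space.restr_def)
  have inj: "inj_on e {..<K}" and img: "e ` {..<K} = {(i, j). i \<le> j \<and> j \<le> n}"
    using e by (auto simp: monomial_order_def bij_betw_def)
  define u :: "nat \<Rightarrow> nat \<Rightarrow> 'a" where "u i r = (if r = i then 1 else 0)" for i r
  have u: "u i \<in> coord_space (n + 1)" if "i \<le> n" for i
    using that by (auto simp: coord_space_def u_def)
  have pick: "(\<Sum>k<K. c $ k * (u (fst (e k0)) (fst (e k)) * u (snd (e k0)) (snd (e k)))) = c $ k0"
    if "k0 < K" for c k0
  proof -
    have "(\<Sum>k<K. c $ k * (u (fst (e k0)) (fst (e k)) * u (snd (e k0)) (snd (e k))))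
        = (\<Sum>k<K. if k = k0 then c $ k else 0)"
    proof (rule sum.cong[OF refl])
      fix k assume "k \<in> {..<K}"
      hence "(k = k0) = (e k = e k0)" using inj that by (auto dest: inj_onD)
      thus "c $ k * (u (fst (e k0)) (fst (e k)) * u (snd (e k0)) (snd (e k)))
          = (if k = k0 then c $ k else 0)"
        by (auto simp: u_def prod_eq_iff)
    qed
    thus ?thesis using that by simp
  qed
  have "a $ k = b $ k" if k: "k < K" for k
  proof -
    obtain i j where ij: "e k = (i, j)" by fastforce
    have le: "fst (e r) \<le> snd (e r)" "snd (e r) \<le> n" if "r < K" for r
      using img that by (auto simp: set_eq_iff image_iff split: prod.splits) (metis prod.collapse lessThan_iff)+
    have le': "i \<le> j" "j \<le> n" using le[OF k] ij by auto
    show ?thesis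
    proof (cases "i = j")
      case True
      have "veronese_form K e c (u i) = c $ k" for c
        using pick[OF k, of c] by (simp add: veronese_form_def ij True)
      thus ?thesis using eq'[OF u, of i] le' by simp
    next
      case False
      have "fun_space.polar (veronese_form K e c) (u i) (u j) = c $ k" for c
      proof -
        \<comment> \<open>Monomials are listed with \<open>fst \<le> snd\<close> and here
          \<open>i < j\<close>, so the transposed term never occurs.\<close>
        have "u j (fst (e r)) * u i (snd (e r)) = 0" if "r < K" for r
          using le[OF that] le' False by (auto simp: u_def)
        hence "fun_space.polar (veronese_form K e c) (u i) (u j)
            = (\<Sum>k<K. c $ k * (u i (fst (e k)) * u j (snd (e k))))"
          unfolding polar_veronese_form by (intro sum.cong) simp_all
        thus ?thesis using pick[OF k, of c] by (simp add: ij)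
      qed
      moreover have "fun_space.polar (veronese_form K e a) (u i) (u j)
          = fun_space.polar (veronese_form K e b) (u i) (u j)"
        using le' u[of i] u[of j] fun_space.subspace_add[OF subspace_coord_space u[of i] u[of j]]
        by (simp add: fun_space.polar_def eq')
      ultimately show ?thesis by simp
    qed
  qed
  thus "a = b" using a b by auto
qed

text \<open>Surjectivity by counting: with \<open>m = n + 1\<close>, the value of \<open>K\<close>
  is \<open>m(m+1)/2\<close>, so there are \<open>q^K\<close> coefficient vectors and equally many
  forms.\<close>

lemma bij_betw_veronese_form:
  assumes "monomial_order n K e" and "K = (n\<^sup>2 + 3 * n + 2) div 2"
  shows "bij_betw (\<lambda>a. fun_space.restr (coord_space (n + 1)) (veronese_form K e a))
    (carrier_vec K :: 'a::{field,finite} vec set)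
    (fun_space.quadratic_forms (coord_space (n + 1)))"
proof -
  let ?F = "\<lambda>a :: 'a vec. fun_space.restr (coord_space (n + 1)) (veronese_form K e a)"
  let ?Q = "fun_space.quadratic_forms (coord_space (n + 1)) :: ((nat \<Rightarrow> 'a) \<Rightarrow> 'a) set"
  have "n\<^sup>2 + 3 * n + 2 = (n + 1) * (n + 1 + 1)"
    by (simp add: power2_eq_square)
  hence "card ?Q = CARD('a) ^ K"
    unfolding assms(2)
    by (simp only: fun_space.card_quadratic_forms[OF subspace_coord_space card_coord_space])
  moreover have "card (?F ` carrier_vec K) = CARD('a) ^ K"
    using card_image[OF inj_on_veronese_form[OF assms(1), where 'a = 'a]] by (simp add: card_carrier_vec)
  moreover have "finite (coord_space (n + 1) :: (nat \<Rightarrow> 'a) set)"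
    by (rule card_ge_0_finite) (simp add: card_coord_space)
  ultimately have "?F ` carrier_vec K = ?Q"
    by (intro card_subset_eq fun_space.finite_quadratic_forms) (auto simp: restr_veronese_form_in)
  thus ?thesis using inj_on_veronese_form[OF assms(1)] by (simp add: bij_betw_def)
qed

section \<open>Codewords as value lists of quadratic forms\<close>

lemma line_eq_iff:
  assumes "v \<in> carrier_vec m" "w \<in> carrier_vec m" "v \<noteq> 0\<^sub>v m"
  shows "line v = line w \<longleftrightarrow> (\<exists>c. c \<noteq> 0 \<and> v = c \<cdot>\<^sub>v w)"
proof
  assume "line v = line w"
  moreover have "v \<in> line v" unfolding line_def by (force intro: exI[of _ 1])
  ultimately obtain c where c: "v = c \<cdot>\<^sub>v w" by (auto simp: line_def)
  moreover have "c \<noteq> 0" using c assms by auto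
  ultimately show "\<exists>c. c \<noteq> 0 \<and> v = c \<cdot>\<^sub>v w" by blast
next
  assume "\<exists>c. c \<noteq> 0 \<and> v = c \<cdot>\<^sub>v w"
  then obtain c where c: "c \<noteq> 0" "v = c \<cdot>\<^sub>v w" by blast
  have 1: "d \<cdot>\<^sub>v w = (d / c) \<cdot>\<^sub>v v" and 2: "d \<cdot>\<^sub>v v = (d * c) \<cdot>\<^sub>v w" for d
    using c by (simp_all add: smult_smult_assoc)
  show "line v = line w"
  proof
    show "line v \<subseteq> line w" unfolding line_def by (clarify, subst 2) (rule exI, simp)
    show "line w \<subseteq> line v" unfolding line_def by (clarify, subst 1) (rule exI, simp)
  qed
qed

text \<open>The row space of \<open>G\<close> is the image of its transpose; for an injective map,
  rank-nullity gives dimension \<open>K\<close>.\<close>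

lemma linear_code_mult_transpose:
  fixes G :: "'a::field mat"
  assumes G: "G \<in> carrier_mat K N"
    and inj: "inj_on (\<lambda>y. transpose_mat G *\<^sub>v y) (carrier_vec K)"
  shows "linear_code N K (generated_code G)"
    and "generated_code G = (\<lambda>y. transpose_mat G *\<^sub>v y) ` carrier_vec K"
proof -
  define T where "T = (\<lambda>y. transpose_mat G *\<^sub>v y)"
  interpret K: vec_space "TYPE('a)" K .
  interpret N: vec_space "TYPE('a)" N .
  have GT: "transpose_mat G \<in> carrier_mat N K" using G by simp
  have hom: "T \<in> LinearCombinations.module_hom class_ring (module_vec TYPE('a) K) (module_vec TYPE('a) N)"
    using GT mult_add_distrib_mat_vec[OF GT] mult_mat_vec[OF GT]
    by (auto simp: LinearCombinations.module_hom_def module_vec_def T_def)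
  have lm: "linear_map class_ring (module_vec TYPE('a) K) (module_vec TYPE('a) N) T"
    by (intro linear_map.intro mod_hom.intro mod_hom_axioms.intro K.vectorspace_axioms
        N.vectorspace_axioms K.module_axioms N.module_axioms hom)
  have "generated_code G = {w \<in> carrier_vec N. \<exists>y\<in>carrier_vec K. T y = w}"
    unfolding generated_code_def T_def using N.row_space_eq[OF G] G by auto
  also have "\<dots> = T ` carrier_vec K" using GT by (auto simp: T_def)
  finally have gen: "generated_code G = T ` carrier_vec K" .
  thus "generated_code G = (\<lambda>y. transpose_mat G *\<^sub>v y) ` carrier_vec K" by (simp only: T_def)
  have im: "generated_code G = mod_hom.im (module_vec TYPE('a) K) T"
    unfolding gen by (subst mod_hom.im_def[OF linear_map.axioms(3)[OF lm]]) (simp add: module_vec_def)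
  have "inj_on T (carrier (module_vec TYPE('a) K))"
    using inj by (simp add: T_def module_vec_def)
  from linear_map.inj_imp_dim_ker0[OF lm this] linear_map.rank_nullity[OF lm K.fin_dim]
  have "vectorspace.dim class_ring (module_vec TYPE('a) N\<lparr>carrier := generated_code G\<rparr>) = K"
    unfolding im K.dim_is_n by simp
  moreover have "VectorSpace.subspace class_ring (generated_code G) (module_vec TYPE('a) N)"
    unfolding im by (rule linear_map.imT_is_subspace[OF lm])
  ultimately show "linear_code N K (generated_code G)" by (simp add: linear_code_def)
qed

text \<open>A form in \<open>n + 1\<close> variables of weight \<open>k\<close> has
  \<open>q^(n+1) - (q-1) k\<close> zeros, so the test function singles out weight \<open>k\<close>.
  The signs are crossed: hyperbolic forms have more zeros, hence the smaller weight and the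
  coefficient \<open>A_minus\<close>.\<close>

lemma zero_enum_eq_coeff_W1:
  assumes q: "q \<ge> 2" and n: "n \<ge> 1"
  shows "zero_enum q (n + 1)
      (\<lambda>\<zeta>. if \<zeta> = of_nat q ^ (n + 1) - (of_nat q - 1) * of_nat k then 1 else 0)
    = coeff (1 + (of_nat q - 1) * W1 q n) k"
    (is "zero_enum q _ ?\<phi> = _")
proof -
  define Q :: rat where "Q = of_nat q"
  have Q: "Q \<noteq> 0" "Q - 1 \<noteq> 0" using q by (auto simp: Q_def)
  have \<phi>: "?\<phi> (Q ^ (n + 1) - (Q - 1) * of_nat w) = (if w = k then 1 else 0)" for w
    using Q by (auto simp: Q_def)
  have mid: "?\<phi> (Q ^ (n + 1) / Q) = (if q ^ n = k then 1 else 0)"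
    using \<phi>[of "q ^ n"] Q by (simp add: algebra_simps Q_def)
  have plus: "?\<phi> (even_rank_zeros q 1 (n + 1) t) = (if q ^ n - q ^ (n - t) = k then 1 else 0)"
    and minus: "?\<phi> (even_rank_zeros q (-1) (n + 1) t) = (if q ^ n + q ^ (n - t) = k then 1 else 0)"
    if t: "t \<le> n" for t
  proof -
    have "q ^ (n - t) \<le> q ^ n" using q by (intro power_increasing) auto
    hence "even_rank_zeros q 1 (n + 1) t = Q ^ (n + 1) - (Q - 1) * of_nat (q ^ n - q ^ (n - t))"
      and "even_rank_zeros q (-1) (n + 1) t = Q ^ (n + 1) - (Q - 1) * of_nat (q ^ n + q ^ (n - t))"
      using Q t by (simp_all add: even_rank_zeros_def Suc_diff_le field_simps flip: Q_def)
    thus "?\<phi> (even_rank_zeros q 1 (n + 1) t) = (if q ^ n - q ^ (n - t) = k then 1 else 0)"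
      and "?\<phi> (even_rank_zeros q (-1) (n + 1) t) = (if q ^ n + q ^ (n - t) = k then 1 else 0)"
      by (simp_all only: \<phi>)
  qed
  have A_mid: "(\<Sum>t\<le>n + 1. odd_rank_count q (n + 1) t) = (Q - 1) * A_mid q n"
  proof -
    have "(\<Sum>t\<le>n + 1. odd_rank_count q (n + 1) t) = (\<Sum>t=0..n div 2. odd_rank_count q (n + 1) t)"
      by (rule sum.mono_neutral_right) (auto intro!: odd_rank_count_eq_0)
    also have "\<dots> = (Q - 1) * A_mid q n"
      unfolding A_mid_def sum_distrib_left odd_rank_count_def alternating_count_Suc_eq Q_def
      by (simp add: mult_ac)
    finally show ?thesis .
  qed
  have A_minus: "even_rank_count q 1 (n + 1) t = (Q - 1) * A_minus q n t"
    and A_plus: "even_rank_count q (-1) (n + 1) t = (Q - 1) * A_plus q n t" if "t \<ge> 1" for t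
  proof -
    have e: "even_rank_count q s (n + 1) t
        = 1 / 2 * gauss_binomial q (n + 1) (2 * t) * (Q ^ t + s) * (Q ^ t * alternating_count q t)" for s
      by (simp add: even_rank_count_def Q_def)
    show "even_rank_count q 1 (n + 1) t = (Q - 1) * A_minus q n t"
      and "even_rank_count q (-1) (n + 1) t = (Q - 1) * A_plus q n t"
      unfolding e alternating_count_eq[OF that, of q, folded Q_def]
      by (simp_all add: A_minus_def A_plus_def Q_def mult_ac)
  qed
  define S where "S = (\<Sum>t=1..(n + 1) div 2.
      (if q ^ n - q ^ (n - t) = k then A_minus q n t else 0)
      + (if q ^ n + q ^ (n - t) = k then A_plus q n t else 0))"
  have coeff_W1: "coeff (W1 q n) k = (if q ^ n = k then A_mid q n else 0) + S"
    by (simp add: W1_def coeff_sum S_def)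
  define E where "E t = even_rank_count q 1 (n + 1) t * ?\<phi> (even_rank_zeros q 1 (n + 1) t)
    + even_rank_count q (-1) (n + 1) t * ?\<phi> (even_rank_zeros q (-1) (n + 1) t)" for t
  have "zero_enum q (n + 1) ?\<phi>
      = (\<Sum>t\<le>n + 1. odd_rank_count q (n + 1) t) * ?\<phi> (Q ^ (n + 1) / Q) + (\<Sum>t\<le>n + 1. E t)"
    unfolding zero_enum_def zero_enum_term_def E_def Q_def
    by (simp only: sum.distrib sum_distrib_right add.assoc)
  also have "(\<Sum>t\<le>n + 1. E t) = E 0 + (\<Sum>t=1..(n + 1) div 2. E t)"
  proof -
    have "(\<Sum>t\<le>n + 1. E t) = (\<Sum>t\<in>insert 0 {1..(n + 1) div 2}. E t)"
      by (rule sum.mono_neutral_right) (auto simp: E_def even_rank_count_eq_0)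
    thus ?thesis by simp
  qed
  \<comment> \<open>The index \<open>t = 0\<close> is the zero form, that is the zero codeword, and
    yields the summand 1 of the enumerator.\<close>
  also have "E 0 = (if k = 0 then 1 else 0)"
    using plus[of 0] by (auto simp: E_def even_rank_count_def)
  also have "(\<Sum>t=1..(n + 1) div 2. E t) = (Q - 1) * S"
    unfolding S_def sum_distrib_left
  proof (rule sum.cong[OF refl])
    fix t assume "t \<in> {1..(n + 1) div 2}"
    hence t: "t \<ge> 1" "t \<le> n" using n by auto
    show "E t = (Q - 1) * ((if q ^ n - q ^ (n - t) = k then A_minus q n t else 0)
      + (if q ^ n + q ^ (n - t) = k then A_plus q n t else 0))"
      unfolding E_def plus[OF t(2)] minus[OF t(2)] A_minus[OF t(1)] A_plus[OF t(1)]
      by (simp add: algebra_simps)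
  qed
  finally have z: "zero_enum q (n + 1) ?\<phi> = (Q - 1) * A_mid q n * (if q ^ n = k then 1 else 0)
      + ((if k = 0 then 1 else 0) + (Q - 1) * S)"
    unfolding mid A_mid .
  have "zero_enum q (n + 1) ?\<phi> = (if k = 0 then 1 else 0) + (Q - 1) * coeff (W1 q n) k"
  proof -
    have "(Q - 1) * a * (if c then 1 else 0) + (b + (Q - 1) * S)
        = b + (Q - 1) * ((if c then a else 0) + S)" for a b c
      by (cases c) (simp_all add: distrib_left)
    thus ?thesis unfolding z coeff_W1 .
  qed
  moreover have "(of_nat q - 1 :: rat poly) = [:Q - 1:]"
    by (simp add: of_nat_poly one_pCons Q_def)
  ultimately show ?thesis by (simp add: coeff_1)
qed

theorem theorem2p1:
  fixes q n N K :: nat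
    and P :: "nat \<Rightarrow> 'a::{field,finite} vec set"
    and e :: "nat \<Rightarrow> nat \<times> nat"
    and G :: "'a mat"
  assumes "q = CARD('a)"
    and "n \<ge> 1"
    and "N = (\<Sum>i=0..n. q ^ i)"
    and "K = (n\<^sup>2 + 3 * n + 2) div 2"
    and "bij_betw P {..<N} (pg_points n)"
    and "monomial_order n K e"
    and "veronese_matrix N K e P G"
  shows "linear_code N K (generated_code G) \<and>
    weight_enumerator (generated_code G) = 1 + (of_nat q - 1) * W1 q n"
proof -
  define m where "m = n + 1"
  define V :: "(nat \<Rightarrow> 'a) set" where "V = coord_space m"
  define fn :: "'a vec \<Rightarrow> nat \<Rightarrow> 'a" where "fn w i = (if i < m then w $ i else 0)" for w i
  let ?T = "\<lambda>y. transpose_mat G *\<^sub>v y"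
  let ?F = "\<lambda>y. fun_space.restr V (veronese_form K e y)"
  have q: "q \<ge> 2" using two_le_card_field[where 'a = 'a] assms(1) by simp
  have V: "fun_space.subspace V" "card V = q ^ m"
    by (simp_all add: V_def subspace_coord_space card_coord_space assms(1))
  have finV: "finite V" using V(2) q by (intro card_ge_0_finite) simp
  have G: "G \<in> carrier_mat K N" using assms(7) by (simp add: veronese_matrix_def)
  have e_le: "fst (e k) < m" "snd (e k) < m" if "k < K" for k
  proof -
    have "e k \<in> {(i, j). i \<le> j \<and> j \<le> n}"
      by (rule bspec[OF bij_betwE[OF assms(6)[unfolded monomial_order_def]]]) (simp add: that)
    thus "fst (e k) < m" "snd (e k) < m" by (auto simp: m_def)
  qed
  have fnV: "fn w \<in> V" for w by (auto simp: fn_def V_def coord_space_def)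
  have fn_vec: "fn (vec m x) = x" if "x \<in> V" for x
    using that by (auto simp: fn_def V_def coord_space_def fun_eq_iff)
  have fn_smult: "fn (c \<cdot>\<^sub>v w) = fun_scale c (fn w)" if "w \<in> carrier_vec m" for c w
    using that by (auto simp: fn_def fun_scale_def fun_eq_iff)
  have vec_fn: "vec m (fun_scale c (fn w)) = c \<cdot>\<^sub>v w" if "w \<in> carrier_vec m" for c w
    using that by (auto simp: fn_def fun_scale_def)

  \<comment> \<open>Any admissible column is a nonzero multiple of the Veronese image of a fixed
    \<open>w\<close> spanning the point; scaling \<open>w\<close> by \<open>c\<close> only
    contributes \<open>c\<^sup>2\<close>. Coordinate \<open>j\<close> of a codeword is therefore a
    nonzero multiple of the value of the form at \<open>w\<close>.\<close>
  have "\<exists>w \<kappa>. w \<in> carrier_vec m \<and> w \<noteq> 0\<^sub>v m \<and> P j = line w \<and> \<kappa> \<noteq> 0 \<and>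
      (\<forall>y\<in>carrier_vec K. ?T y $ j = \<kappa> * veronese_form K e y (fn w))" if j: "j < N" for j
  proof -
    have "P j \<in> pg_points n" using assms(5) j by (auto simp: bij_betw_def)
    then obtain w where w: "w \<in> carrier_vec m" "w \<noteq> 0\<^sub>v m" "P j = line w"
      by (auto simp: pg_points_def m_def)
    have col: "col G j \<in> veronese_point K e (P j)" "col G j \<noteq> 0\<^sub>v K"
      using assms(7) j by (auto simp: veronese_matrix_def)
    then obtain c s where cs: "col G j = s \<cdot>\<^sub>v veronese K e (c \<cdot>\<^sub>v w)"
      unfolding w(3) veronese_point_def line_def by auto
    have ent: "col G j $ k = (s * c\<^sup>2) * (fn w (fst (e k)) * fn w (snd (e k)))" if "k < K" for k
      using that w(1) e_le[OF that] by (simp add: cs veronese_def fn_def power2_eq_square mult_ac)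
    have "s * c\<^sup>2 \<noteq> 0"
    proof
      assume "s * c\<^sup>2 = 0"
      hence "col G j = 0\<^sub>v K" using G j ent by (intro eq_vecI) auto
      thus False using col(2) by simp
    qed
    moreover have "?T y $ j = s * c\<^sup>2 * veronese_form K e y (fn w)" if "y \<in> carrier_vec K" for y
    proof -
      have "?T y $ j = col G j \<bullet> y" using G j by simp
      also have "\<dots> = (\<Sum>k<K. col G j $ k * y $ k)"
        using that by (simp add: scalar_prod_def atLeast0LessThan)
      also have "\<dots> = s * c\<^sup>2 * veronese_form K e y (fn w)"
        unfolding veronese_form_def sum_distrib_left
        by (rule sum.cong[OF refl]) (simp add: ent mult_ac del: index_col)
      finally show ?thesis .
    qed
    ultimately show ?thesis using w by blast
  qed
  then obtain w \<kappa> where w: "\<And>j. j < N \<Longrightarrow> w j \<in> carrier_vec m" "\<And>j. j < N \<Longrightarrow> w j \<noteq> 0\<^sub>v m"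
      "\<And>j. j < N \<Longrightarrow> P j = line (w j)" and \<kappa>: "\<And>j. j < N \<Longrightarrow> \<kappa> j \<noteq> 0"
      "\<And>j y. j < N \<Longrightarrow> y \<in> carrier_vec K \<Longrightarrow> ?T y $ j = \<kappa> j * veronese_form K e y (fn (w j))"
    by metis

  have repr: "\<exists>j<N. \<exists>c. c \<noteq> 0 \<and> x = fun_scale c (fn (w j))" if x: "x \<in> V" "x \<noteq> 0" for x
  proof -
    have vx: "vec m x \<in> carrier_vec m" "vec m x \<noteq> 0\<^sub>v m"
    proof -
      show "vec m x \<noteq> 0\<^sub>v m"
      proof
        assume "vec m x = 0\<^sub>v m"
        hence "fn (vec m x) = 0" by (simp add: fn_def fun_eq_iff)
        thus False using x fn_vec by simp
      qed
    qed simp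
    hence "line (vec m x) \<in> pg_points n" by (auto simp: pg_points_def m_def)
    then obtain j where j: "j < N" "P j = line (vec m x)"
      unfolding bij_betw_imp_surj_on[OF assms(5), symmetric] by auto
    then obtain c where c: "c \<noteq> 0" "vec m x = c \<cdot>\<^sub>v w j"
      using line_eq_iff[OF vx(1) w(1)[OF j(1)] vx(2)] w(3)[OF j(1)] by auto
    have "x = fun_scale c (fn (w j))"
      using fn_vec[OF x(1)] c(2) fn_smult[OF w(1)[OF j(1)]] by simp
    thus ?thesis using j(1) c(1) by blast
  qed

  \<comment> \<open>Equal codewords give forms that agree at one representative of each point, hence
    by homogeneity on all of \<open>V\<close>, and then their coefficients agree.\<close>
  have inj: "inj_on ?T (carrier_vec K)"
  proof (rule inj_onI)
    fix y y' assume y: "y \<in> carrier_vec K" "y' \<in> carrier_vec K" and eq: "?T y = ?T y'"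
    have "veronese_form K e y x = veronese_form K e y' x" if xV: "x \<in> V" for x
    proof (cases "x = 0")
      case True
      thus ?thesis by (simp add: veronese_form_def)
    next
      case False
      then obtain j c where j: "j < N" "x = fun_scale c (fn (w j))" using repr[OF xV] by blast
      have "veronese_form K e y (fn (w j)) = veronese_form K e y' (fn (w j))"
        using \<kappa>(2)[OF j(1) y(1)] \<kappa>(2)[OF j(1) y(2)] \<kappa>(1)[OF j(1)] eq by simp
      thus ?thesis by (simp add: j(2) veronese_form_scale)
    qed
    hence "?F y = ?F y'" by (auto simp: fun_space.restr_def fun_eq_iff)
    thus "y = y'"
      using inj_onD[OF inj_on_veronese_form[OF assms(6)]] y by (simp add: V_def m_def)
  qed

  \<comment> \<open>Each nonzero coordinate accounts for the \<open>q - 1\<close> nonzero multiples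
    of its representative, and these are all the vectors where the form does not vanish.\<close>
  have weight: "of_nat (fun_space.zeros V (?F y)) = (of_nat q ^ m - (of_nat q - 1) * of_nat (wt (?T y)) :: rat)"
    if y: "y \<in> carrier_vec K" for y
  proof -
    define J where "J = {j. j < N \<and> ?T y $ j \<noteq> 0}"
    have wt: "wt (?T y) = card J" using G by (simp add: wt_def J_def)
    have "bij_betw (\<lambda>(j, c). fun_scale c (fn (w j))) (J \<times> (UNIV - {0})) {x \<in> V. veronese_form K e y x \<noteq> 0}"
      unfolding bij_betw_def
    proof
      show "inj_on (\<lambda>(j, c). fun_scale c (fn (w j))) (J \<times> (UNIV - {0}))"
      proof -
        have key: "i = j \<and> c = d" if i: "i \<in> J" and j: "j \<in> J" and c: "c \<noteq> 0" and d: "d \<noteq> 0"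
          and eq: "fun_scale c (fn (w i)) = fun_scale d (fn (w j))" for i j c d
        proof -
          have iN: "i < N" and jN: "j < N" using i j by (auto simp: J_def)
          have eq': "c \<cdot>\<^sub>v w i = d \<cdot>\<^sub>v w j"
            using arg_cong[OF eq, of "vec m"] vec_fn w(1) iN jN by simp
          hence "inverse c \<cdot>\<^sub>v (c \<cdot>\<^sub>v w i) = inverse c \<cdot>\<^sub>v (d \<cdot>\<^sub>v w j)" by simp
          hence wi: "w i = (d / c) \<cdot>\<^sub>v w j"
            using c by (simp add: smult_smult_assoc field_simps)
          have "d / c \<noteq> 0" using c d by simp
          hence "line (w i) = line (w j)"
            using line_eq_iff[OF w(1)[OF iN] w(1)[OF jN] w(2)[OF iN]] wi by blast
          hence "P i = P j" using w(3)[OF iN] w(3)[OF jN] by simp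
          hence ij: "i = j"
            using inj_onD[OF bij_betw_imp_inj_on[OF assms(5)]] iN jN by simp
          obtain r where r: "r < m" "w i $ r \<noteq> 0"
            using w(1,2)[OF iN] by (metis carrier_vecD eq_vecI index_zero_vec)
          have "c * w i $ r = d * w i $ r"
            using fun_cong[OF eq, of r] r by (simp add: fun_scale_def fn_def ij)
          thus ?thesis using ij r by simp
        qed
        show ?thesis
        proof (rule inj_onI)
          fix p p' assume "p \<in> J \<times> (UNIV - {0})" "p' \<in> J \<times> (UNIV - {0})"
            and "(case p of (j, c) \<Rightarrow> fun_scale c (fn (w j))) = (case p' of (j, c) \<Rightarrow> fun_scale c (fn (w j)))"
          thus "p = p'" using key[of "fst p" "fst p'" "snd p" "snd p'"]
            by (simp add: case_prod_beta mem_Times_iff prod_eq_iff)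
        qed
      qed
      show "(\<lambda>(j, c). fun_scale c (fn (w j))) ` (J \<times> (UNIV - {0})) = {x \<in> V. veronese_form K e y x \<noteq> 0}"
        (is "?L = ?R")
      proof
        show "?L \<subseteq> ?R"
          using \<kappa>(2)[OF _ y] fun_space.subspace_scale[OF V(1) fnV]
          by (auto simp: J_def veronese_form_scale)
        show "?R \<subseteq> ?L"
        proof
          fix x assume x: "x \<in> ?R"
          hence "x \<noteq> 0" by (auto simp: veronese_form_def)
          then obtain j c where j: "j < N" "c \<noteq> 0" "x = fun_scale c (fn (w j))" using repr[of x] x by blast
          hence "j \<in> J" using x \<kappa>[OF j(1)] y by (auto simp: J_def veronese_form_scale)
          thus "x \<in> ?L" using j by force
        qed
      qed
    qed
    hence "card {x \<in> V. veronese_form K e y x \<noteq> 0} = card J * (q - 1)"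
      by (simp add: card_cartesian_product assms(1) card_Diff_singleton flip: bij_betw_same_card)
    moreover have "fun_space.zeros V (?F y) = card {x \<in> V. veronese_form K e y x = 0}"
      unfolding fun_space.zeros_def by (rule arg_cong[where f = card]) (auto simp: fun_space.restr_def)
    moreover have "card V = card {x \<in> V. veronese_form K e y x = 0} + card {x \<in> V. veronese_form K e y x \<noteq> 0}"
      using finV by (subst card_Un_disjoint[symmetric]) (auto intro: arg_cong[where f = card])
    ultimately have "q ^ m = fun_space.zeros V (?F y) + card J * (q - 1)" using V(2) by simp
    hence "of_nat (q ^ m) = (of_nat (fun_space.zeros V (?F y) + card J * (q - 1)) :: rat)" by simp
    thus ?thesis using q by (simp add: wt mult.commute)
  qed

  have code: "linear_code N K (generated_code G)" and gen: "generated_code G = ?T ` carrier_vec K"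
    by (rule linear_code_mult_transpose[OF G inj])+
  have "coeff (weight_enumerator (generated_code G)) k = coeff (1 + (of_nat q - 1) * W1 q n) k" for k
  proof -
    let ?\<phi> = "\<lambda>\<zeta> :: rat. if \<zeta> = of_nat q ^ m - (of_nat q - 1) * of_nat k then 1 else 0 :: rat"
    have "coeff (weight_enumerator (generated_code G)) k
        = (\<Sum>y\<in>carrier_vec K. if wt (?T y) = k then 1 else 0)"
      unfolding weight_enumerator_def gen by (simp add: sum.reindex[OF inj] coeff_sum)
    \<comment> \<open>Since \<open>q - 1\<close> is nonzero, the number of zeros determines the
      weight, so the two indicators coincide.\<close>
    also have "\<dots> = (\<Sum>y\<in>carrier_vec K. ?\<phi> (of_nat (fun_space.zeros V (?F y))))"
      using q by (intro sum.cong refl) (simp add: weight)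
    also have "\<dots> = (\<Sum>f\<in>fun_space.quadratic_forms V. ?\<phi> (of_nat (fun_space.zeros V f)))"
      unfolding V_def m_def
      by (rule sum.reindex_bij_betw[OF bij_betw_veronese_form[OF assms(6,4)]])
    also have "\<dots> = zero_enum q m ?\<phi>"
      unfolding assms(1) by (rule fun_space.sum_quadratic_forms_zeros) (use V assms(1) in simp_all)
    also have "\<dots> = coeff (1 + (of_nat q - 1) * W1 q n) k"
      unfolding m_def by (rule zero_enum_eq_coeff_W1[OF q assms(2)])
    finally show ?thesis .
  qed
  thus ?thesis using code by (simp add: poly_eq_iff)
qed

end
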